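(* Let $0<q<1$ and $-1<\alpha<q$. A polynomial realization of the basis $\{\varphi_n^{(q)}\}_{n=0}^\infty$ of $\mathcal{H}$ (in the sense described in the context) is given by $$\varphi_n^{(q)}(x)=\left((-\alpha,q;q)_n\right)^{-1/2}\,Q_n\!\left(\frac{x\sqrt{1-q}}{2};\sqrt{\alpha},-\sqrt{\alpha}\,\Big|\,q\right),\qquad n=0,1,2,\dots,$$ in terms of the Al-Salam-Chihara polynomials $Q_n(\xi;a,b|q)$.
   Context: Notation: $(a;q)_n=\prod_{k=0}^{n-1}(1-aq^k)$, $(a_1,\dots,a_m;q)_n=\prod_i(a_i;q)_n$, $[n]_q=\frac{1-q^n}{1-q}$, $x_n^{q,\alpha}=(1+\alpha q^{n-1})[n]_q$. The symbol $\sqrt\alpha$ is any square root of $\alpha$ (imaginary if $\alpha<0$). Al-Salam-Chihara polynomials: for $\xi=\cos\theta$, $$Q_n(\xi;a,b|q)=\frac{(ab;q)_n}{a^n}\;{}_3\phi_2\!\left(\begin{matrix}q^{-n},\,ae^{i\theta},\,ae^{-i\theta}\\ ab,\,0\end{matrix}\,\Big|\,q;q\right),\qquad {}_3\phi_2\!\left(\begin{matrix}a_1,a_2,a_3\\ b_1,b_2\end{matrix}\Big|q;t\right)=\sum_{k\ge0}\frac{(a_1,a_2,a_3;q)_k}{(b_1,b_2;q)_k}\frac{t^k}{(q;q)_k},$$ extended by polynomial continuity to $a=0$ (for $\alpha=0$ they reduce to the continuous $q$-Hermite polynomials). Meaning of "polynomial realization": $\mathcal{H}$ is a Hilbert space with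 orthonormal basis $\{\varphi_n^{(q)}\}_{n\ge0}$. Define operators by $a\varphi_n^{(q)}=\sqrt{2x_n^{q,\alpha}}\,\varphi_{n-1}^{(q)}$, $a\varphi_0^{(q)}=0$, $a^*\varphi_n^{(q)}=\sqrt{2x_{n+1}^{q,\alpha}}\,\varphi_{n+1}^{(q)}$, and let $Q=\frac{1}{\sqrt2}(a+a^* )$, so that $Q\varphi_n^{(q)}=\sqrt{x_n^{q,\alpha}}\,\varphi_{n-1}^{(q)}+\sqrt{x_{n+1}^{q,\alpha}}\,\varphi_{n+1}^{(q)}$ (with the first term absent for $n=0$). $Q$ has a unique self-adjoint extension, also denoted $Q$, with spectral family $E_x$, and $\omega(dx)=d\langle\varphi_0^{(q)}|E_x|\varphi_0^{(q)}\rangle$. On $L^2(\mathbb{R},\omega(dx))$ the operator $Q$ is realized as multiplication by $x$, and $\varphi_n^{(q)}$ is realized as the polynomial $\varphi_n^{(q)}(x)$ of degree $n$ obtained by orthonormalizing $1,x,x^2,\dots$ with respect to $\omega$; these satisfy $\varphi_0^{(q)}(x)=1$, $$x\varphi_n^{(q)}(x)=\sqrt{x_n^{q,\alpha}}\,\varphi_{n-1}^{(q)}(x)+\sqrt{x_{n+1}^{q,\alpha}}\,\varphi_{n+1}^{(q)}(x),\qquad \int_{\mathbb{R}}\varphi_k^{(q)}(x)\varphi_n^{(q)}(x)\,\omega(dx)=\delta_{k,n}.$$ *)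

theory Defs
  imports "HOL-Analysis.Analysis" "HOL-Computational_Algebra.Polynomial"
begin

definition qpoch :: "'a::comm_ring_1 \<Rightarrow> 'a \<Rightarrow> nat \<Rightarrow> 'a" where
  "qpoch a q n = (\<Prod>k<n. 1 - a * q ^ k)"

definition qpochs :: "'a::comm_ring_1 list \<Rightarrow> 'a \<Rightarrow> nat \<Rightarrow> 'a" where
  "qpochs as q n = (\<Prod>a\<leftarrow>as. qpoch a q n)"

definition qnum :: "real \<Rightarrow> nat \<Rightarrow> real" where
  "qnum q n = (1 - q ^ n) / (1 - q)"

(* For n = 0 the truncated exponent is harmless, since qnum q 0 = 0. *)
definition xseq :: "real \<Rightarrow> real \<Rightarrow> nat \<Rightarrow> real" where
  "xseq q \<alpha> n = (1 + \<alpha> * q ^ (n - 1)) * qnum q n"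

definition phi32 ::
  "complex \<Rightarrow> complex \<Rightarrow> complex \<Rightarrow> complex \<Rightarrow> complex \<Rightarrow> complex \<Rightarrow> complex \<Rightarrow> complex" where
  "phi32 a1 a2 a3 b1 b2 q t =
     (\<Sum>k. qpochs [a1, a2, a3] q k / qpochs [b1, b2] q k * (t ^ k / qpoch q q k))"

(* The right-hand side for \<xi> = cos \<theta>, with \<theta> complex so that every \<xi> is covered. It is a
   function of exp (\<i> \<theta>) that is invariant under \<theta> \<mapsto> - \<theta>, so the choice of \<theta>, here
   Arccos \<xi>, does not matter. *)
definition asc_formula :: "nat \<Rightarrow> complex \<Rightarrow> complex \<Rightarrow> real \<Rightarrow> complex \<Rightarrow> complex" where
  "asc_formula n a b q \<xi> =
     (let \<theta> = Arccos \<xi>; q' = complex_of_real q in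
        qpoch (a * b) q' n / a ^ n *
        phi32 (q' powi (- int n)) (a * exp (\<i> * \<theta>)) (a * exp (- (\<i> * \<theta>))) (a * b) 0 q' q')"

(* For a \<noteq> 0 near 0 the formula is a polynomial in a; its value at a = 0 is the limit. *)
definition al_salam_chihara :: "nat \<Rightarrow> complex \<Rightarrow> complex \<Rightarrow> real \<Rightarrow> complex \<Rightarrow> complex" where
  "al_salam_chihara n a b q \<xi> =
     (if a = 0 then Lim (at 0) (\<lambda>a'. asc_formula n a' b q \<xi>) else asc_formula n a b q \<xi>)"

(* The underlying real Hilbert space supplies norm and topology;
   cinner is conjugate-linear in its first argument. *)
class complex_hilbert_space = real_inner + complete_space +
  fixes scaleC :: "complex \<Rightarrow> 'a \<Rightarrow> 'a" (infixr "*\<^sub>C" 75)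
    and cinner :: "'a \<Rightarrow> 'a \<Rightarrow> complex"
  assumes scaleC_add_right: "c *\<^sub>C (x + y) = c *\<^sub>C x + c *\<^sub>C y"
    and scaleC_add_left: "(c + d) *\<^sub>C x = c *\<^sub>C x + d *\<^sub>C x"
    and scaleC_scaleC: "c *\<^sub>C (d *\<^sub>C x) = (c * d) *\<^sub>C x"
    and scaleC_one: "1 *\<^sub>C x = x"
    and scaleR_scaleC: "r *\<^sub>R x = complex_of_real r *\<^sub>C x"
    and cinner_commute: "cinner x y = cnj (cinner y x)"
    and cinner_add_right: "cinner x (y + z) = cinner x y + cinner x z"
    and cinner_scaleC_right: "cinner x (c *\<^sub>C y) = c * cinner x y"
    and inner_eq_Re_cinner: "inner x y = Re (cinner x y)"

interpretation cvec: vector_space "scaleC :: complex \<Rightarrow> 'a \<Rightarrow> 'a::complex_hilbert_space"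
  by unfold_locales (rule scaleC_add_right scaleC_add_left scaleC_scaleC scaleC_one)+

definition orthonormal_basis :: "(nat \<Rightarrow> 'a::complex_hilbert_space) \<Rightarrow> bool" where
  "orthonormal_basis \<phi> \<longleftrightarrow>
     (\<forall>m n. cinner (\<phi> m) (\<phi> n) = (if m = n then 1 else 0)) \<and>
     closure (cvec.span (range \<phi>)) = UNIV"

definition clinear_on :: "'a set \<Rightarrow> ('a::complex_hilbert_space \<Rightarrow> 'a) \<Rightarrow> bool" where
  "clinear_on D T \<longleftrightarrow>
     (\<forall>u\<in>D. \<forall>v\<in>D. T (u + v) = T u + T v) \<and> (\<forall>c. \<forall>u\<in>D. T (c *\<^sub>C u) = c *\<^sub>C T u)"

definition annihilation_operator ::
  "real \<Rightarrow> real \<Rightarrow> (nat \<Rightarrow> 'a::complex_hilbert_space) \<Rightarrow> ('a \<Rightarrow> 'a) \<Rightarrow> bool" where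
  "annihilation_operator q \<alpha> \<phi> a \<longleftrightarrow>
     clinear_on (cvec.span (range \<phi>)) a \<and> a (\<phi> 0) = 0 \<and>
     (\<forall>n\<ge>1. a (\<phi> n) = complex_of_real (sqrt (2 * xseq q \<alpha> n)) *\<^sub>C \<phi> (n - 1))"

definition creation_operator ::
  "real \<Rightarrow> real \<Rightarrow> (nat \<Rightarrow> 'a::complex_hilbert_space) \<Rightarrow> ('a \<Rightarrow> 'a) \<Rightarrow> bool" where
  "creation_operator q \<alpha> \<phi> a \<longleftrightarrow>
     clinear_on (cvec.span (range \<phi>)) a \<and>
     (\<forall>n. a (\<phi> n) = complex_of_real (sqrt (2 * xseq q \<alpha> (n + 1))) *\<^sub>C \<phi> (n + 1))"

(* A possibly unbounded operator is a pair (D, T): only the values of T on its domain D matter.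
   The last conjunct says that the graphs of T and of its adjoint coincide. *)
definition self_adjoint :: "'a::complex_hilbert_space set \<Rightarrow> ('a \<Rightarrow> 'a) \<Rightarrow> bool" where
  "self_adjoint D T \<longleftrightarrow>
     cvec.subspace D \<and> closure D = UNIV \<and> clinear_on D T \<and>
     (\<forall>v w. (v \<in> D \<and> T v = w) \<longleftrightarrow> (\<forall>u\<in>D. cinner (T u) v = cinner u w))"

definition orthogonal_projection :: "('a::complex_hilbert_space \<Rightarrow> 'a) \<Rightarrow> bool" where
  "orthogonal_projection P \<longleftrightarrow>
     clinear_on UNIV P \<and> (\<forall>u. P (P u) = P u) \<and> (\<forall>u v. cinner (P u) v = cinner u (P v))"

definition spectral_family :: "(real \<Rightarrow> 'a::complex_hilbert_space \<Rightarrow> 'a) \<Rightarrow> bool" where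
  "spectral_family E \<longleftrightarrow>
     (\<forall>x. orthogonal_projection (E x)) \<and>
     (\<forall>x y u. E x (E y u) = E (min x y) u) \<and>
     (\<forall>x u. ((\<lambda>y. E y u) \<longlongrightarrow> E x u) (at_right x)) \<and>
     (\<forall>u. ((\<lambda>y. E y u) \<longlongrightarrow> 0) at_bot) \<and>
     (\<forall>u. ((\<lambda>y. E y u) \<longlongrightarrow> u) at_top)"

(* The measure d<u | E_x | u>. *)
definition spectral_distribution ::
  "(real \<Rightarrow> 'a::complex_hilbert_space \<Rightarrow> 'a) \<Rightarrow> 'a \<Rightarrow> real measure" where
  "spectral_distribution E u = interval_measure (\<lambda>x. Re (cinner u (E x u)))"

(* T is the integral of x dE_x, with its natural domain; the quadratic form determines T on D
   by polarization. *)
definition spectral_family_of ::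
  "'a::complex_hilbert_space set \<Rightarrow> ('a \<Rightarrow> 'a) \<Rightarrow> (real \<Rightarrow> 'a \<Rightarrow> 'a) \<Rightarrow> bool" where
  "spectral_family_of D T E \<longleftrightarrow>
     spectral_family E \<and>
     D = {u. integrable (spectral_distribution E u) (\<lambda>x. x\<^sup>2)} \<and>
     (\<forall>u\<in>D. cinner u (T u) = complex_of_real (\<integral>x. x \<partial>spectral_distribution E u))"

definition L2 :: "real measure \<Rightarrow> (real \<Rightarrow> complex) set" where
  "L2 M = {f \<in> borel_measurable M. integrable M (\<lambda>x. (cmod (f x))\<^sup>2)}"

(* Unitary maps onto the Hilbert space of classes modulo M-a.e. equality, in terms of
   representatives. *)
definition unitary_onto_L2 ::
  "real measure \<Rightarrow> ('a::complex_hilbert_space \<Rightarrow> real \<Rightarrow> complex) \<Rightarrow> bool" where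
  "unitary_onto_L2 M U \<longleftrightarrow>
     (\<forall>u. U u \<in> L2 M) \<and>
     (\<forall>u v. AE x in M. U (u + v) x = U u x + U v x) \<and>
     (\<forall>c u. AE x in M. U (c *\<^sub>C u) x = c * U u x) \<and>
     (\<forall>u v. (\<integral>x. cnj (U u x) * U v x \<partial>M) = cinner u v) \<and>
     (\<forall>f\<in>L2 M. \<exists>u. AE x in M. U u x = f x)"

(* Gram-Schmidt applied to 1, x, x^2, ... *)
definition orthonormalized_monomials :: "real measure \<Rightarrow> (nat \<Rightarrow> real poly) \<Rightarrow> bool" where
  "orthonormalized_monomials M p \<longleftrightarrow>
     (\<forall>n. integrable M (\<lambda>x. x ^ n)) \<and>
     (\<forall>n. let g = monom 1 n - (\<Sum>k<n. smult (\<integral>x. poly (p k) x * x ^ n \<partial>M) (p k))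
          in (\<integral>x. (poly g x)\<^sup>2 \<partial>M) > 0 \<and>
             p n = smult (1 / sqrt (\<integral>x. (poly g x)\<^sup>2 \<partial>M)) g)"

definition polynomial_realization ::
  "real \<Rightarrow> real \<Rightarrow> (nat \<Rightarrow> 'a::complex_hilbert_space) \<Rightarrow> 'a set \<Rightarrow> ('a \<Rightarrow> 'a) \<Rightarrow>
   real measure \<Rightarrow> (nat \<Rightarrow> real \<Rightarrow> complex) \<Rightarrow> bool" where
  "polynomial_realization q \<alpha> \<phi> D T \<omega> f \<longleftrightarrow>
     (\<exists>p. (\<forall>n x. f n x = complex_of_real (poly (p n) x)) \<and>
          (\<forall>n. degree (p n) = n) \<and>
          orthonormalized_monomials \<omega> p \<and>
          p 0 = 1 \<and>
          (\<forall>n x. x * poly (p n) x =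
             (if n = 0 then 0 else sqrt (xseq q \<alpha> n) * poly (p (n - 1)) x)
             + sqrt (xseq q \<alpha> (n + 1)) * poly (p (n + 1)) x) \<and>
          (\<forall>k n. (\<integral>x. poly (p k) x * poly (p n) x \<partial>\<omega>) = (if k = n then 1 else 0))) \<and>
     (\<exists>U. unitary_onto_L2 \<omega> U \<and>
          (\<forall>n. AE x in \<omega>. U (\<phi> n) x = f n x) \<and>
          (\<forall>u. u \<in> D \<longleftrightarrow> (\<lambda>x. complex_of_real x * U u x) \<in> L2 \<omega>) \<and>
          (\<forall>u\<in>D. AE x in \<omega>. U (T u) x = complex_of_real x * U u x))"

end

theory Submission
  imports Defs "HOL-Probability.Probability"
begin

text \<open>
  The recurrence coefficients are bounded, so \<open>D = UNIV\<close> and \<open>T\<close> is bounded; hence the spectral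
  family is constant outside a compact interval. Approximating \<open>T\<close> in norm by the Riemann sums
  \<open>\<Sum> t\<^sub>k (E t\<^sub>k\<^sub>+\<^sub>1 - E t\<^sub>k)\<close> shows that the polynomials \<open>p\<^sub>n\<close> defined by the three-term recurrence
  satisfy \<open>p\<^sub>n(T) \<phi>\<^sub>0 = \<phi>\<^sub>n\<close> and are orthonormal for \<open>\<omega>\<close>. Polynomials are dense in \<open>L\<^sup>2(\<omega>)\<close> by Weierstrass,
  so a function is determined by its coefficients with respect to \<open>p\<^sub>n\<close>, and the unitary map is the one
  that preserves coefficients. Comparing coefficients of the factors \<open>(a e\<^sup>i\<^sup>\<theta>, a e\<^sup>-\<^sup>i\<^sup>\<theta>; q)\<^sub>k\<close> gives the
  three-term recurrence of the Al-Salam-Chihara polynomials, which identifies them with \<open>p\<^sub>n\<close>.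
\<close>

section \<open>The recurrence of the Al-Salam-Chihara polynomials\<close>

text \<open>\<open>a\<close> and \<open>astar\<close> prescribe \<open>T\<close> only on the span of
  the basis, and \<open>T\<close> is tied to \<open>E\<close> only through the quadratic form <u, T
  u>, so everything about powers of \<open>T\<close> has to be extracted from that form. Two facts
  achieve this. The norm of a symmetric operator is controlled by its quadratic form, so an error of
  1/N in the form is an error of 1/N in norm. Increments of \<open>E\<close> over disjoint intervals
  are mutually orthogonal projections, so Riemann sums on one grid multiply like functions. The
  compact spectrum makes finite grids sufficient. As the polynomials are real, the real part of the
  inner product carries all of this. On the side of special functions, a = s and b = -s give a + b =
  0 and ab = -\<alpha>: the middle term of the recurrence disappears, in accordance with the zero
  diagonal of Q, and -1 < \<alpha> yields both x_n > 0 and nonzero denominators (ab;q)_k. The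
  scaling 2 \<xi> = x sqrt(1-q) is forced by (1-q^n)(1+\<alpha> q^(n-1)) = (1-q) x_n.\<close>

lemma qpoch_0 [simp]: "qpoch a q 0 = 1"
  by (simp add: qpoch_def)

lemma qpoch_Suc: "qpoch a q (Suc n) = qpoch a q n * (1 - a * q ^ n)"
  by (simp add: qpoch_def)

lemma qpoch_Suc_shift: "qpoch a q (Suc n) = (1 - a) * qpoch (a * q) q n"
  by (simp add: qpoch_def prod.lessThan_Suc_shift mult.assoc del: prod.lessThan_Suc)

lemma qpoch_zero_left [simp]: "qpoch 0 q n = 1"
  by (simp add: qpoch_def)

text \<open>Free of \<xi>: these are the coefficients of the polynomial in the basis
  \<open>asc_factor a q \<xi> k\<close>, so a recurrence in n can be checked for each k
  separately.\<close>

definition asc_coeff :: "complex \<Rightarrow> complex \<Rightarrow> complex \<Rightarrow> nat \<Rightarrow> nat \<Rightarrow> complex" where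
  "asc_coeff a b q n k =
     qpoch (a * b) q n / a ^ n * (qpoch (q powi (- int n)) q k * q ^ k / (qpoch (a * b) q k * qpoch q q k))"

text \<open>This is (a e^(i \<theta>), a e^(-i \<theta>); q)_k multiplied out, which eliminates
  \<theta> in favour of \<xi> = cos \<theta>.\<close>

definition asc_factor :: "complex \<Rightarrow> complex \<Rightarrow> complex \<Rightarrow> nat \<Rightarrow> complex" where
  "asc_factor a q \<xi> k = (\<Prod>j<k. 1 - 2 * a * \<xi> * q ^ j + a\<^sup>2 * (q ^ j)\<^sup>2)"

lemma asc_factor_eq_qpoch:
  assumes "cos \<theta> = \<xi>"
  shows "qpoch (a * exp (\<i> * \<theta>)) q k * qpoch (a * exp (- (\<i> * \<theta>))) q k = asc_factor a q \<xi> k"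
proof -
  have e: "exp (\<i> * \<theta>) * exp (- (\<i> * \<theta>)) = 1"
    by (simp add: exp_minus)
  have c: "exp (\<i> * \<theta>) + exp (- (\<i> * \<theta>)) = 2 * \<xi>"
    using assms by (simp add: cos_exp_eq)
  have "(1 - a * exp (\<i> * \<theta>) * t) * (1 - a * exp (- (\<i> * \<theta>)) * t) = 1 - 2 * a * \<xi> * t + a\<^sup>2 * t\<^sup>2" for t
  proof -
    have "(1 - a * exp (\<i> * \<theta>) * t) * (1 - a * exp (- (\<i> * \<theta>)) * t)
       = 1 - a * t * (exp (\<i> * \<theta>) + exp (- (\<i> * \<theta>))) + a\<^sup>2 * t\<^sup>2 * (exp (\<i> * \<theta>) * exp (- (\<i> * \<theta>)))"
      by (simp add: algebra_simps power2_eq_square)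
    then show ?thesis by (simp add: e c)
  qed
  then show ?thesis
    by (simp add: qpoch_def asc_factor_def flip: prod.distrib)
qed

text \<open>The factor with index n is zero; this terminates the hypergeometric series.\<close>

lemma qpoch_negative_power_eq_0:
  fixes q :: complex
  assumes "q \<noteq> 0" "n < k"
  shows "qpoch (q powi (- int n)) q k = 0"
proof -
  have "q powi (- int n) * q ^ n = 1"
    using assms by (simp add: power_int_minus)
  then show ?thesis using assms(2) by (force simp: qpoch_def)
qed

text \<open>The bound \<open>N\<close> is left free above n so that the polynomials for n - 1, n and
  n + 1 can be summed over one range.\<close>

lemma asc_formula_eq_sum:
  assumes "0 < q" "n \<le> N"
  shows "asc_formula n a b q \<xi> = (\<Sum>k\<le>N. asc_coeff a b (complex_of_real q) n k * asc_factor a (complex_of_real q) \<xi> k)"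
proof -
  define q' where "q' = complex_of_real q"
  define \<theta> where "\<theta> = Arccos \<xi>"
  have q': "q' \<noteq> 0" using assms by (simp add: q'_def)
  have fac: "qpoch (a * exp (\<i> * \<theta>)) q' k * qpoch (a * exp (- (\<i> * \<theta>))) q' k = asc_factor a q' \<xi> k" for k
    by (rule asc_factor_eq_qpoch) (simp add: \<theta>_def)
  have term_eq: "qpochs [q' powi (- int n), a * exp (\<i> * \<theta>), a * exp (- (\<i> * \<theta>))] q' k / qpochs [a * b, 0] q' k * (q' ^ k / qpoch q' q' k)
     = qpoch (q' powi (- int n)) q' k * q' ^ k / (qpoch (a * b) q' k * qpoch q' q' k) * asc_factor a q' \<xi> k" for k
    by (simp add: qpochs_def fac mult_ac flip: fac)
  have "phi32 (q' powi (- int n)) (a * exp (\<i> * \<theta>)) (a * exp (- (\<i> * \<theta>))) (a * b) 0 q' q' =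
    (\<Sum>k\<le>N. qpoch (q' powi (- int n)) q' k * q' ^ k / (qpoch (a * b) q' k * qpoch q' q' k) * asc_factor a q' \<xi> k)"
    unfolding phi32_def term_eq
    by (rule suminf_finite) (use assms q' in \<open>auto simp: qpoch_negative_power_eq_0\<close>)
  then show ?thesis
    unfolding asc_formula_def Let_def asc_coeff_def q'_def[symmetric] \<theta>_def[symmetric]
    by (simp add: sum_distrib_left mult_ac)
qed

text \<open>This compares the coefficients of A_k = \<open>asc_factor a q \<xi> k\<close> in the
  three-term recurrence. The left side comes from 2 \<xi> A_k = (1/(a q^k) + a q^k) A_k - A_(k+1)/(a
  q^k), which passes a contribution from k - 1 to k.\<close>

lemma asc_coeff_recurrence:
  assumes q: "q \<noteq> 0" and a: "a \<noteq> 0"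
    and ab: "\<And>j. a * b * q ^ j \<noteq> 1" and qq: "\<And>j. q ^ Suc j \<noteq> 1"
  shows "asc_coeff a b q n k * (1 / (q ^ k * a) + a * q ^ k)
           - (if k = 0 then 0 else asc_coeff a b q n (k - 1) / (q ^ (k - 1) * a))
         = asc_coeff a b q (Suc n) k + (a + b) * q ^ n * asc_coeff a b q n k
           + (1 - q ^ n) * (1 - a * b * q ^ (n - 1)) * asc_coeff a b q (n - 1) k"
proof -
  \<comment> \<open>In terms of z = q^(-n), and later t = q^(k-1), the claim becomes a rational
    identity in a, b, q, z, t.\<close>
  define z where "z = q powi (- int n)"
  have z0: "z \<noteq> 0" and rz: "q ^ n = 1 / z"
    using q by (simp_all add: z_def power_int_minus field_simps)
  have pw: "q powi (- int m) = inverse (q ^ m)" for m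
    by (simp only: power_int_minus power_int_of_nat)
  have zS: "q powi (- int (Suc n)) = z / q"
    unfolding z_def pw using q by (simp add: field_simps)
  define W where "W = qpoch (a * b) q n / a ^ n"
  have cn: "asc_coeff a b q n j = W * (qpoch z q j * q ^ j / (qpoch (a * b) q j * qpoch q q j))" for j
    by (simp add: asc_coeff_def W_def z_def)
  have cS: "asc_coeff a b q (Suc n) j = W * (1 - a * b / z) / a * (qpoch (z / q) q j * q ^ j / (qpoch (a * b) q j * qpoch q q j))" for j
    unfolding asc_coeff_def zS qpoch_Suc W_def rz by (simp add: field_simps)
  \<comment> \<open>For n = 0 the truncated index n - 1 is harmless: both sides vanish because q^n =
    z = 1.\<close>
  have cP: "(1 - q ^ n) * (1 - a * b * q ^ (n - 1)) * asc_coeff a b q (n - 1) j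
     = W * a * (1 - 1 / z) * (qpoch (z * q) q j * q ^ j / (qpoch (a * b) q j * qpoch q q j))" for j
  proof (cases n)
    case 0
    then show ?thesis by (simp add: z_def)
  next
    case (Suc m)
    have "q powi (- int m) = z * q"
      unfolding z_def pw using q by (simp add: Suc)
    moreover have "W * a = qpoch (a * b) q m / a ^ m * (1 - a * b * q ^ m)"
      using a by (simp add: W_def Suc qpoch_Suc)
    ultimately show ?thesis
      unfolding asc_coeff_def rz[symmetric] by (simp add: Suc mult_ac)
  qed
  show ?thesis
  proof (cases k)
    case 0
    then show ?thesis
      unfolding cP cS cn unfolding rz using a z0 by (simp add: field_simps) 
  next
    case (Suc m)
    define t where "t = q ^ m"
    have t0: "t \<noteq> 0" using q by (simp add: t_def)
    define Y where "Y = qpoch z q m"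
    define B where "B = qpoch (a * b) q m"
    define R where "R = qpoch q q m"
    have B0: "B \<noteq> 0" "R \<noteq> 0"
      using ab qq by (auto simp: B_def R_def qpoch_def)
    have B1: "1 - a * b * t \<noteq> 0" "1 - q * t \<noteq> 0"
      using ab[of m] qq[of m] by (auto simp: t_def)
    have e1: "qpoch z q k = Y * (1 - z * t)" "qpoch (a * b) q k = B * (1 - a * b * t)"
      "qpoch q q k = R * (1 - q * t)" "q ^ k = q * t"
      by (simp_all add: Suc qpoch_Suc Y_def B_def R_def t_def)
    have e2: "qpoch (z / q) q k = (1 - z / q) * Y"
      using q by (simp add: Suc qpoch_Suc_shift Y_def)
    \<comment> \<open>The factor 1 - z stays on the left because it is zero when n = 0; the product
      is (z;q)_(k+1).\<close>
    have e3: "(1 - z) * qpoch (z * q) q k = Y * (1 - z * t) * (1 - z * q * t)"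
      unfolding qpoch_Suc_shift[symmetric] by (simp add: Suc qpoch_Suc Y_def t_def mult_ac)
    have e4: "(1 - 1 / z) * qpoch (z * q) q k = - (Y * (1 - z * t) * (1 - z * q * t) / z)"
      unfolding e3[symmetric] using z0 by (simp add: field_simps)
    have e5: "W * a * (1 - 1 / z) * (qpoch (z * q) q k * q ^ k / (qpoch (a * b) q k * qpoch q q k))
       = W * a * q ^ k / (qpoch (a * b) q k * qpoch q q k) * ((1 - 1 / z) * qpoch (z * q) q k)"
      by simp
    \<comment> \<open>The common factor of all four coefficients; once it is taken out,
      \<open>key\<close> is all that remains.\<close>
    define C where "C = W * Y * q * t / (B * (1 - a * b * t) * (R * (1 - q * t)))"
    have x1: "asc_coeff a b q n k = C * (1 - z * t)"
      unfolding cn e1 by (simp add: C_def)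
    have x2: "asc_coeff a b q n m = C * (1 - a * b * t) * (1 - q * t) / q"
      unfolding cn using B0 B1 q by (simp add: C_def t_def[symmetric] Y_def[symmetric] B_def[symmetric] R_def[symmetric])
    have x3: "asc_coeff a b q (Suc n) k = C * (1 - a * b / z) * (1 - z / q) / a"
      unfolding cS e2 e1 C_def by (simp add: mult_ac)
    have x4: "(1 - q ^ n) * (1 - a * b * q ^ (n - 1)) * asc_coeff a b q (n - 1) k = - C * a * (1 - z * t) * (1 - z * q * t) / z"
      unfolding cP e5 e4 unfolding e1 C_def by (simp add: mult_ac)
    have key: "(1 - z * t) * (1 / (q * t * a) + a * (q * t)) - (1 - a * b * t) * (1 - q * t) / (q * t * a)
      = (1 - a * b / z) * (1 - z / q) / a + (a + b) / z * (1 - z * t) - a * (1 - z * t) * (1 - z * q * t) / z"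
      using a q z0 t0 by (simp add: divide_simps) algebra
    have "asc_coeff a b q n k * (1 / (q ^ k * a) + a * q ^ k)
           - (if k = 0 then 0 else asc_coeff a b q n (k - 1) / (q ^ (k - 1) * a))
        = C * ((1 - z * t) * (1 / (q * t * a) + a * (q * t)) - (1 - a * b * t) * (1 - q * t) / (q * t * a))"
      unfolding x1 e1(4) by (subst right_diff_distrib) (use x2 in \<open>simp add: Suc t_def[symmetric] mult_ac\<close>)
    also have "\<dots> = C * (1 - a * b / z) * (1 - z / q) / a + (a + b) * (1 / z) * (C * (1 - z * t)) + - C * a * (1 - z * t) * (1 - z * q * t) / z"
      unfolding key by (subst right_diff_distrib, subst distrib_left) (simp add: mult_ac)
    finally show ?thesis
      unfolding x4 x3 unfolding x1 rz .
  qed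
qed

lemma asc_formula_recurrence:
  assumes q: "0 < q" "q < 1" and a: "a \<noteq> 0" and ab: "\<And>j. a * b * of_real q ^ j \<noteq> 1"
  shows "2 * \<xi> * asc_formula n a b q \<xi> =
    asc_formula (Suc n) a b q \<xi> + (a + b) * of_real q ^ n * asc_formula n a b q \<xi>
    + (1 - of_real q ^ n) * (1 - a * b * of_real q ^ (n - 1)) * asc_formula (n - 1) a b q \<xi>"
proof -
  define q' where "q' = complex_of_real q"
  define c where "c = asc_coeff a b q'"
  define A where "A = asc_factor a q' \<xi>"
  have q': "q' \<noteq> 0" using q by (simp add: q'_def)
  have qq: "q' ^ Suc j \<noteq> 1" for j
  proof
    assume "q' ^ Suc j = 1"
    then have "q ^ Suc j = 1"
      unfolding q'_def by (metis of_real_eq_1_iff of_real_power)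
    moreover have "q ^ Suc j < 1" using q by (intro power_Suc_less_one)
    ultimately show False by simp
  qed
  have sums: "asc_formula m a b q \<xi> = (\<Sum>k\<le>Suc n. c m k * A k)" if "m \<le> Suc n" for m
    unfolding c_def A_def q'_def using asc_formula_eq_sum that q by blast
  have A: "2 * \<xi> * A k = (1 / (q' ^ k * a) + a * q' ^ k) * A k - A (Suc k) / (q' ^ k * a)" for k
    unfolding A_def asc_factor_def using a q' by (simp add: divide_simps) algebra
  have "2 * \<xi> * asc_formula n a b q \<xi> = (\<Sum>k\<le>n. c n k * (2 * \<xi> * A k))"
    unfolding c_def A_def q'_def by (subst asc_formula_eq_sum[of q n n]) (use q in \<open>auto simp: sum_distrib_left mult_ac\<close>)
  also have "\<dots> = (\<Sum>k\<le>n. c n k * (1 / (q' ^ k * a) + a * q' ^ k) * A k) - (\<Sum>k\<le>n. c n k / (q' ^ k * a) * A (Suc k))"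
    unfolding A by (simp add: algebra_simps sum_subtractf)
  \<comment> \<open>The added term k = n + 1 is zero because the series for n has
    terminated.\<close>
  also have "(\<Sum>k\<le>n. c n k * (1 / (q' ^ k * a) + a * q' ^ k) * A k) = (\<Sum>k\<le>Suc n. c n k * (1 / (q' ^ k * a) + a * q' ^ k) * A k)"
    using qpoch_negative_power_eq_0[OF q', of n "Suc n"] by (simp add: c_def asc_coeff_def)
  also have "(\<Sum>k\<le>n. c n k / (q' ^ k * a) * A (Suc k)) =
     (\<Sum>k\<le>Suc n. (if k = 0 then 0 else c n (k - 1) / (q' ^ (k - 1) * a)) * A k)"
    by (simp add: sum.atMost_Suc_shift del: sum.atMost_Suc)
  also have "(\<Sum>k\<le>Suc n. c n k * (1 / (q' ^ k * a) + a * q' ^ k) * A k) - \<dots> =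
    (\<Sum>k\<le>Suc n. (c n k * (1 / (q' ^ k * a) + a * q' ^ k) - (if k = 0 then 0 else c n (k - 1) / (q' ^ (k - 1) * a))) * A k)"
    by (simp only: sum_subtractf[symmetric] left_diff_distrib)
  also have "\<dots> = (\<Sum>k\<le>Suc n. (c (Suc n) k + (a + b) * q' ^ n * c n k
           + (1 - q' ^ n) * (1 - a * b * q' ^ (n - 1)) * c (n - 1) k) * A k)"
    unfolding c_def using asc_coeff_recurrence[OF q' a ab[folded q'_def] qq] by simp
  also have "\<dots> = (\<Sum>k\<le>Suc n. c (Suc n) k * A k) + (a + b) * q' ^ n * (\<Sum>k\<le>Suc n. c n k * A k)
    + (1 - q' ^ n) * (1 - a * b * q' ^ (n - 1)) * (\<Sum>k\<le>Suc n. c (n - 1) k * A k)"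
    by (simp only: sum_distrib_left sum.distrib[symmetric] distrib_right mult.assoc)
  finally show ?thesis
    by (simp add: sums q'_def)
qed

lemma asc_formula_0 [simp]: "0 < q \<Longrightarrow> asc_formula 0 a b q \<xi> = 1"
  by (subst asc_formula_eq_sum[of q 0 0]) (auto simp: asc_coeff_def asc_factor_def)

text \<open>Needed twice: for the positivity of x_n, and for ab q^j \<noteq> 1 when ab = -\<alpha>.
  For negative \<alpha> the worst case is j = 0.\<close>

lemma one_plus_mult_power_pos:
  fixes q \<alpha> :: real
  assumes q: "0 < q" "q < 1" and \<alpha>: "-1 < \<alpha>"
  shows "0 < 1 + \<alpha> * q ^ j"
proof -
  have *: "0 < q ^ j" "q ^ j \<le> 1" using q by (auto simp: power_le_one)
  show ?thesis
  proof (cases "\<alpha> \<ge> 0")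
    case True
    then show ?thesis using * by (auto intro!: add_pos_nonneg)
  next
    case False
    then have "\<alpha> \<le> \<alpha> * q ^ j"
      using * mult_left_mono_neg[of "q ^ j" 1 \<alpha>] by simp
    then show ?thesis using \<alpha> by linarith
  qed
qed

lemma al_salam_chihara_recurrence:
  fixes q \<alpha> :: real and s \<xi> :: complex
  defines "Q \<equiv> (\<lambda>n. al_salam_chihara n s (- s) q \<xi>)"
  assumes q: "0 < q" "q < 1" and \<alpha>: "-1 < \<alpha>" and s: "s\<^sup>2 = complex_of_real \<alpha>"
  shows "Q 0 = 1"
    "2 * \<xi> * Q n = Q (Suc n) + (1 - of_real q ^ n) * (1 + of_real \<alpha> * of_real q ^ (n - 1)) * Q (n - 1)"
proof -
  have "Q 0 = 1 \<and> 2 * \<xi> * Q n = Q (Suc n) + (1 - of_real q ^ n) * (1 + of_real \<alpha> * of_real q ^ (n - 1)) * Q (n - 1)"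
  proof (cases "s = 0")
    case False
    have "s * - s * of_real q ^ j \<noteq> 1" for j
    proof -
      have "s * - s * of_real q ^ j = of_real (- \<alpha> * q ^ j)"
        using s by (simp add: power2_eq_square)
      moreover have "- \<alpha> * q ^ j \<noteq> 1" using one_plus_mult_power_pos[OF q \<alpha>, of j] by simp
      ultimately show ?thesis by (metis of_real_eq_1_iff)
    qed
    from asc_formula_recurrence[OF q False this, of \<xi> n] False q show ?thesis
      by (simp add: Q_def al_salam_chihara_def s[symmetric] power2_eq_square)
  next
    \<comment> \<open>Here b = -s = 0 stays fixed while the first parameter tends to 0, so the
      recurrence is used with b = 0 and passed to the limit.\<close>
    case True
    then have \<alpha>0: "\<alpha> = 0" using s by simp
    have F0: "((\<lambda>a. asc_formula 0 a 0 q \<xi>) \<longlongrightarrow> 1) (at 0)"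
      using q by simp
    have rec: "\<forall>\<^sub>F a in at 0. asc_formula (Suc m) a 0 q \<xi> = 2 * \<xi> * asc_formula m a 0 q \<xi> - a * of_real q ^ m * asc_formula m a 0 q \<xi>
        - (1 - of_real q ^ m) * asc_formula (m - 1) a 0 q \<xi>" for m
    proof -
      have "asc_formula (Suc m) a 0 q \<xi> = 2 * \<xi> * asc_formula m a 0 q \<xi> - a * of_real q ^ m * asc_formula m a 0 q \<xi>
        - (1 - of_real q ^ m) * asc_formula (m - 1) a 0 q \<xi>" if "a \<noteq> 0" for a
        using asc_formula_recurrence[OF q that, of 0 \<xi> m] by (simp add: algebra_simps)
      then show ?thesis by (auto simp: eventually_at_filter)
    qed
    have step: "((\<lambda>a. asc_formula (Suc m) a 0 q \<xi>) \<longlongrightarrow> 2 * \<xi> * L - (1 - of_real q ^ m) * L') (at 0)"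
      if "((\<lambda>a. asc_formula m a 0 q \<xi>) \<longlongrightarrow> L) (at 0)" "((\<lambda>a. asc_formula (m - 1) a 0 q \<xi>) \<longlongrightarrow> L') (at 0)" for m L L'
    proof (subst tendsto_cong[OF rec])
      have "((\<lambda>a. 2 * \<xi> * asc_formula m a 0 q \<xi> - a * of_real q ^ m * asc_formula m a 0 q \<xi>
        - (1 - of_real q ^ m) * asc_formula (m - 1) a 0 q \<xi>) \<longlongrightarrow> 2 * \<xi> * L - 0 * of_real q ^ m * L - (1 - of_real q ^ m) * L') (at 0)"
        by (intro tendsto_intros that)
      then show "((\<lambda>a. 2 * \<xi> * asc_formula m a 0 q \<xi> - a * of_real q ^ m * asc_formula m a 0 q \<xi>
        - (1 - of_real q ^ m) * asc_formula (m - 1) a 0 q \<xi>) \<longlongrightarrow> 2 * \<xi> * L - (1 - of_real q ^ m) * L') (at 0)" by simp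
    qed
    \<comment> \<open>\<open>Lim\<close> has a meaningful value only if the limit exists, and the
      recurrence provides this by induction.\<close>
    have ex: "\<exists>L. ((\<lambda>a. asc_formula m a 0 q \<xi>) \<longlongrightarrow> L) (at 0)" for m
    proof (induction m rule: less_induct)
      case (less m)
      show ?case
      proof (cases m)
        case 0
        then show ?thesis using F0 by blast
      next
        case (Suc k)
        then show ?thesis using less step[of k] by (metis less_Suc_eq_le diff_le_self lessI)
      qed
    qed
    have lim: "((\<lambda>a. asc_formula m a 0 q \<xi>) \<longlongrightarrow> Q m) (at 0)" for m
    proof -
      obtain L where "((\<lambda>a. asc_formula m a 0 q \<xi>) \<longlongrightarrow> L) (at 0)" using ex by blast
      then show ?thesis using True by (auto simp: Q_def al_salam_chihara_def tendsto_Lim)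
    qed
    have "Q 0 = 1"
      using tendsto_unique[OF _ lim[of 0] F0] by simp
    moreover have "Q (Suc n) = 2 * \<xi> * Q n - (1 - of_real q ^ n) * Q (n - 1)"
      using tendsto_unique[OF _ lim[of "Suc n"] step[OF lim lim]] by simp
    ultimately show ?thesis using \<alpha>0 by simp
  qed
  then show "Q 0 = 1" "2 * \<xi> * Q n = Q (Suc n) + (1 - of_real q ^ n) * (1 + of_real \<alpha> * of_real q ^ (n - 1)) * Q (n - 1)"
    by auto
qed

section \<open>Complex Hilbert spaces and bounded Jacobi operators\<close>

instance complex_hilbert_space \<subseteq> banach ..

text \<open>For non-real scalars the class relates scaling to the norm only through
  \<open>cinner\<close> and its real part, so homogeneity has to be derived; it rests on <x, x>
  being real.\<close>

lemma norm_scaleC: "norm (c *\<^sub>C (x::'a::complex_hilbert_space)) = cmod c * norm x"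
proof -
  have "cinner x x = cnj (cinner x x)" by (rule cinner_commute)
  then have Im0: "Im (cinner x x) = 0" by (simp add: complex_eq_iff)
  have left: "cinner (c *\<^sub>C x) y = cnj c * cinner x y" for y
    by (subst cinner_commute, subst (2) cinner_commute) (simp add: cinner_scaleC_right)
  have "inner (c *\<^sub>C x) (c *\<^sub>C x) = (cmod c)\<^sup>2 * inner x x"
    by (simp add: inner_eq_Re_cinner left cinner_scaleC_right Im0 cmod_power2)
       (simp add: algebra_simps power2_eq_square)
  then have "(norm (c *\<^sub>C x))\<^sup>2 = (cmod c)\<^sup>2 * (norm x)\<^sup>2"
    unfolding power2_norm_eq_inner[of x] power2_norm_eq_inner[of "c *\<^sub>C x"] .
  then show ?thesis
    by (metis norm_ge_zero power2_eq_iff_nonneg power_mult_distrib zero_le_mult_iff)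
qed

text \<open>Recovers the complex inner product from the real one, so that real Cauchy-Schwarz
  applies to both parts.\<close>

lemma Im_cinner_eq_inner: "Im (cinner x y) = inner x ((- \<i>) *\<^sub>C y)"
  unfolding inner_eq_Re_cinner cinner_scaleC_right by simp

lemma cinner_add_left: "cinner (x + y) z = cinner x z + cinner y z"
  by (metis cinner_add_right cinner_commute complex_cnj_add)

lemma cinner_scaleC_left: "cinner (c *\<^sub>C x) y = cnj c * cinner x y"
  by (metis cinner_commute cinner_scaleC_right complex_cnj_mult)

text \<open>Bounding real and imaginary part separately gives the constant 2; it is not sharp, but
  continuity needs no more.\<close>

interpretation cinner: bounded_bilinear "cinner :: 'a::complex_hilbert_space \<Rightarrow> 'a \<Rightarrow> complex"
proof
  show "\<exists>K. \<forall>a b::'a. cmod (cinner a b) \<le> norm a * norm b * K"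
  proof (intro exI allI)
    fix a b :: 'a
    have "cmod (cinner a b) \<le> \<bar>Re (cinner a b)\<bar> + \<bar>Im (cinner a b)\<bar>"
      by (rule cmod_le)
    also have "\<dots> \<le> norm a * norm b + norm a * norm ((- \<i>) *\<^sub>C b)"
      unfolding Im_cinner_eq_inner inner_eq_Re_cinner[symmetric]
      by (intro add_mono Cauchy_Schwarz_ineq2)
    finally show "cmod (cinner a b) \<le> norm a * norm b * 2"
      by (simp add: norm_scaleC)
  qed
qed (simp_all add: cinner_add_left cinner_add_right scaleR_scaleC cinner_scaleC_left
    cinner_scaleC_right scaleR_conv_of_real)

interpretation scaleC: bounded_bilinear "scaleC :: complex \<Rightarrow> 'a::complex_hilbert_space \<Rightarrow> 'a"
proof
  show "\<exists>K. \<forall>a (b::'a). norm (a *\<^sub>C b) \<le> norm a * norm b * K"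
    by (rule exI[of _ 1]) (simp add: norm_scaleC)
qed (simp_all add: scaleC_add_right scaleC_add_left scaleR_scaleC scaleC_scaleC scaleR_conv_of_real mult.commute)

section \<open>Fourier expansion in orthonormal sequences\<close>

definition orthonormal :: "(nat \<Rightarrow> 'a::complex_hilbert_space) \<Rightarrow> bool" where
  "orthonormal \<phi> \<longleftrightarrow> (\<forall>m n. cinner (\<phi> m) (\<phi> n) = (if m = n then 1 else 0))"

context
  fixes \<phi> :: "nat \<Rightarrow> 'a::complex_hilbert_space"
  assumes on: "orthonormal \<phi>"
begin

lemma cinner_orthonormal_sum:
  "finite F \<Longrightarrow> cinner (\<phi> m) (\<Sum>n\<in>F. c n *\<^sub>C \<phi> n) = (if m \<in> F then c m else 0)"
  by (simp add: cinner.sum_right cinner_scaleC_right on[unfolded orthonormal_def, rule_format] if_distrib cong: if_cong)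

lemma norm_orthonormal_sum:
  assumes "finite F"
  shows "(norm (\<Sum>n\<in>F. c n *\<^sub>C \<phi> n))\<^sup>2 = (\<Sum>n\<in>F. (cmod (c n))\<^sup>2)"
proof -
  have "cinner (\<Sum>n\<in>F. c n *\<^sub>C \<phi> n) (\<Sum>n\<in>F. c n *\<^sub>C \<phi> n) = (\<Sum>n\<in>F. cnj (c n) * c n)"
    by (subst cinner.sum_left) (simp add: cinner_scaleC_left cinner_orthonormal_sum assms)
  also have "\<dots> = of_real (\<Sum>n\<in>F. (cmod (c n))\<^sup>2)"
    by (simp only: of_real_sum complex_norm_square mult.commute)
  finally show ?thesis
    by (simp add: power2_norm_eq_inner inner_eq_Re_cinner)
qed

lemma orthonormal_bessel:
  assumes "finite F"
  shows "(\<Sum>n\<in>F. (cmod (cinner (\<phi> n) u))\<^sup>2) \<le> (norm u)\<^sup>2"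
proof -
  let ?S = "\<Sum>n\<in>F. cinner (\<phi> n) u *\<^sub>C \<phi> n"
  let ?s = "\<Sum>n\<in>F. (cmod (cinner (\<phi> n) u))\<^sup>2"
  have "cinner u ?S = (\<Sum>n\<in>F. cinner (\<phi> n) u * cnj (cinner (\<phi> n) u))"
    by (subst cinner.sum_right) (simp add: cinner_scaleC_right flip: cinner_commute)
  also have "\<dots> = of_real ?s"
    by (simp only: of_real_sum complex_norm_square)
  finally have "inner u ?S = ?s"
    by (simp add: inner_eq_Re_cinner)
  moreover have "(norm (u - ?S))\<^sup>2 = (norm u)\<^sup>2 - 2 * inner u ?S + (norm ?S)\<^sup>2"
    by (simp add: power2_norm_eq_inner inner_diff_left inner_diff_right inner_commute)
  ultimately show ?thesis
    using norm_orthonormal_sum[OF assms, of "\<lambda>n. cinner (\<phi> n) u"] zero_le_power2[of "norm (u - ?S)"]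
    by simp
qed

lemma summable_orthonormal:
  assumes "summable (\<lambda>n. (cmod (c n))\<^sup>2)"
  shows "summable (\<lambda>n. c n *\<^sub>C \<phi> n)"
  unfolding summable_Cauchy
proof (intro allI impI)
  fix e :: real assume e: "e > 0"
  with assms obtain N where N: "norm (\<Sum>k=m..<n. (cmod (c k))\<^sup>2) < e\<^sup>2" if "m \<ge> N" for m n
    unfolding summable_Cauchy by (meson zero_less_power)
  have "norm (\<Sum>k=m..<n. c k *\<^sub>C \<phi> k) < e" if "m \<ge> N" for m n
  proof -
    have "(norm (\<Sum>k=m..<n. c k *\<^sub>C \<phi> k))\<^sup>2 < e\<^sup>2"
      using N[OF that, of n] by (simp add: norm_orthonormal_sum sum_nonneg)
    then show ?thesis using e by (simp add: power_less_imp_less_base)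
  qed
  then show "\<exists>N. \<forall>m\<ge>N. \<forall>n. norm (\<Sum>k=m..<n. c k *\<^sub>C \<phi> k) < e" by blast
qed

lemma summable_fourier_coeffs: "summable (\<lambda>n. (cmod (cinner (\<phi> n) u))\<^sup>2)"
  by (rule summableI_nonneg_bounded[of _ "(norm u)\<^sup>2"]) (auto intro: orthonormal_bessel)

lemma cinner_orthonormal_suminf:
  assumes "(\<lambda>n. c n *\<^sub>C \<phi> n) sums u"
  shows "cinner (\<phi> m) u = c m"
proof -
  have "(\<lambda>N. cinner (\<phi> m) (\<Sum>n<N. c n *\<^sub>C \<phi> n)) \<longlonglongrightarrow> cinner (\<phi> m) u"
    using assms unfolding sums_def by (intro cinner.tendsto tendsto_const)
  moreover have "\<forall>\<^sub>F N in sequentially. cinner (\<phi> m) (\<Sum>n<N. c n *\<^sub>C \<phi> n) = c m"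
    using eventually_gt_at_top[of m] by eventually_elim (simp add: cinner_orthonormal_sum)
  ultimately show ?thesis
    by (metis LIMSEQ_unique tendsto_eventually)
qed

end

lemma orthonormal_basis_imp_orthonormal: "orthonormal_basis \<phi> \<Longrightarrow> orthonormal \<phi>"
  by (simp add: orthonormal_basis_def orthonormal_def)

text \<open>The remainder r is orthogonal to the span of the basis and, by continuity, to its
  closure, hence to itself.\<close>

lemma orthonormal_basis_expansion:
  fixes \<phi> :: "nat \<Rightarrow> 'a::complex_hilbert_space"
  assumes "orthonormal_basis \<phi>"
  shows "(\<lambda>n. cinner (\<phi> n) u *\<^sub>C \<phi> n) sums u"
proof -
  note on = orthonormal_basis_imp_orthonormal[OF assms]
  define c where "c n = cinner (\<phi> n) u" for n
  define v where "v = (\<Sum>n. c n *\<^sub>C \<phi> n)"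
  have s: "(\<lambda>n. c n *\<^sub>C \<phi> n) sums v"
    unfolding v_def c_def
    by (intro summable_sums summable_orthonormal[OF on] summable_fourier_coeffs[OF on])
  define r where "r = u - v"
  have \<phi>r: "cinner (\<phi> m) r = 0" for m
    using cinner_orthonormal_suminf[OF on s] by (simp add: r_def cinner.diff_right c_def)
  have "cinner x r = 0" if "x \<in> cvec.span (range \<phi>)" for x
    using that
    by (induction rule: cvec.span_induct_alt) (auto simp: cinner_add_left cinner_scaleC_left \<phi>r cinner.zero_left)
  moreover have "r \<in> closure (cvec.span (range \<phi>))"
    using assms by (simp add: orthonormal_basis_def)
  then obtain x where "\<And>n. x n \<in> cvec.span (range \<phi>)" "x \<longlonglongrightarrow> r"
    unfolding closure_sequential by blast
  ultimately have "cinner r r = 0"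
    using cinner.tendsto[OF \<open>x \<longlonglongrightarrow> r\<close> tendsto_const, of r] by (simp add: LIMSEQ_const_iff)
  then have "inner r r = 0" by (simp add: inner_eq_Re_cinner)
  then have "u = v" by (simp add: r_def)
  then show ?thesis using s by (simp add: c_def)
qed

text \<open>Weights bounded by \<open>B\<close> enlarge an l2 norm at most by the factor
  \<open>B\<close>. This serves each of the two off-diagonals of a Jacobi matrix.\<close>

lemma orthonormal_weighted_sum:
  fixes \<phi> :: "nat \<Rightarrow> 'a::complex_hilbert_space" and b :: "nat \<Rightarrow> real"
  assumes on: "orthonormal \<phi>" and c: "summable (\<lambda>n. (cmod (c n))\<^sup>2)" and le: "(\<Sum>n. (cmod (c n))\<^sup>2) \<le> C\<^sup>2"
    and b: "\<And>n. \<bar>b n\<bar> \<le> B" and C: "0 \<le> C"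
  shows "summable (\<lambda>n. (c n * of_real (b n)) *\<^sub>C \<phi> n)" "norm (\<Sum>n. (c n * of_real (b n)) *\<^sub>C \<phi> n) \<le> B * C"
proof -
  have B: "0 \<le> B" using b[of 0] by linarith
  have bB: "(cmod (c n * of_real (b n)))\<^sup>2 \<le> B\<^sup>2 * (cmod (c n))\<^sup>2" for n
    using mult_left_mono[OF power_mono[OF b[of n] abs_ge_zero, of 2], of "(cmod (c n))\<^sup>2"]
    by (simp add: norm_mult power_mult_distrib mult.commute)
  have "summable (\<lambda>n. (cmod (c n * of_real (b n)))\<^sup>2)"
    by (rule summable_comparison_test'[OF summable_mult[OF c, of "B\<^sup>2"], of 0]) (use bB in auto)
  then show *: "summable (\<lambda>n. (c n * of_real (b n)) *\<^sub>C \<phi> n)"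
    by (rule summable_orthonormal[OF on])
  have "norm (\<Sum>n<N. (c n * of_real (b n)) *\<^sub>C \<phi> n) \<le> B * C" for N
  proof (rule power2_le_imp_le)
    have "(norm (\<Sum>n<N. (c n * of_real (b n)) *\<^sub>C \<phi> n))\<^sup>2 = (\<Sum>n<N. (cmod (c n * of_real (b n)))\<^sup>2)"
      by (simp add: norm_orthonormal_sum[OF on])
    also have "\<dots> \<le> B\<^sup>2 * (\<Sum>n<N. (cmod (c n))\<^sup>2)"
      unfolding sum_distrib_left by (rule sum_mono) (rule bB)
    also have "\<dots> \<le> B\<^sup>2 * C\<^sup>2"
      by (intro mult_left_mono order_trans[OF sum_le_suminf[OF c] le]) auto
    finally show "(norm (\<Sum>n<N. (c n * of_real (b n)) *\<^sub>C \<phi> n))\<^sup>2 \<le> (B * C)\<^sup>2"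
      by (simp add: power_mult_distrib)
  qed (use B C in simp)
  then show "norm (\<Sum>n. (c n * of_real (b n)) *\<^sub>C \<phi> n) \<le> B * C"
    using * by (intro Lim_bounded[OF tendsto_norm[OF summable_LIMSEQ]]) auto
qed

text \<open>
  The Fourier partial sums \<open>S N\<close> of \<open>u\<close> and their images \<open>T (S N)\<close> both converge, so \<open>u\<close> lies in the
  domain of the adjoint of \<open>T\<close>, which is \<open>D\<close>.
\<close>
lemma self_adjoint_bounded_jacobi:
  fixes \<phi> :: "nat \<Rightarrow> 'a::complex_hilbert_space" and b :: "nat \<Rightarrow> real"
  assumes sa: "self_adjoint D T" and basis: "orthonormal_basis \<phi>"
    and \<phi>D: "\<And>n. \<phi> n \<in> D"
    and T\<phi>: "\<And>n. T (\<phi> n) = (if n = 0 then 0 else of_real (b n) *\<^sub>C \<phi> (n - 1)) + of_real (b (Suc n)) *\<^sub>C \<phi> (Suc n)"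
    and b: "\<And>n. \<bar>b n\<bar> \<le> B"
  shows "D = UNIV" "norm (T u) \<le> 2 * B * norm u"
proof -
  note on = orthonormal_basis_imp_orthonormal[OF basis]
  have on': "orthonormal (\<lambda>n. \<phi> (Suc n))"
    using on by (simp add: orthonormal_def)
  have sub: "cvec.subspace D" and lin: "clinear_on D T"
    and adj: "\<And>v w. (v \<in> D \<and> T v = w) \<longleftrightarrow> (\<forall>u\<in>D. cinner (T u) v = cinner u w)"
    using sa by (auto simp: self_adjoint_def)
  have T0: "T 0 = 0"
    using lin \<phi>D[of 0] unfolding clinear_on_def by (metis scaleC.zero_left)
  have main: "u \<in> D \<and> norm (T u) \<le> 2 * B * norm u" for u
  proof -
    define c where "c n = cinner (\<phi> n) u" for n
    define S where "S N = (\<Sum>n<N. c n *\<^sub>C \<phi> n)" for N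
    have SD: "S N \<in> D" for N
      unfolding S_def by (intro cvec.subspace_sum cvec.subspace_scale sub \<phi>D)
    have TS: "T (S N) = (\<Sum>n<N. c n *\<^sub>C T (\<phi> n))" for N
    proof (induction N)
      case 0
      then show ?case by (simp add: S_def T0)
    next
      case (Suc N)
      have "T (S (Suc N)) = T (S N + c N *\<^sub>C \<phi> N)"
        by (simp add: S_def)
      also have "\<dots> = T (S N) + c N *\<^sub>C T (\<phi> N)"
        using lin SD[of N] \<phi>D[of N] cvec.subspace_scale[OF sub \<phi>D[of N], of "c N"]
        by (simp add: clinear_on_def)
      finally show ?case using Suc by simp
    qed
    have Su: "S \<longlonglongrightarrow> u"
      using orthonormal_basis_expansion[OF basis, of u] by (simp add: sums_def S_def[abs_def] c_def)
    have c: "summable (\<lambda>n. (cmod (c n))\<^sup>2)"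
      unfolding c_def by (rule summable_fourier_coeffs[OF on])
    have cle: "(\<Sum>n. (cmod (c n))\<^sup>2) \<le> (norm u)\<^sup>2"
      using c unfolding c_def by (intro suminf_le_const orthonormal_bessel[OF on]) auto
    have c': "summable (\<lambda>n. (cmod (c (Suc n)))\<^sup>2)"
      using c by (subst summable_Suc_iff)
    have cle': "(\<Sum>n. (cmod (c (Suc n)))\<^sup>2) \<le> (norm u)\<^sup>2"
      using suminf_split_head[OF c] cle zero_le_power2[of "cmod (c 0)"] by linarith
    \<comment> \<open>\<open>g\<close> and \<open>h\<close> are the contributions of the lower and
      the upper off-diagonal; each sums to norm at most B |u|, whence the constant 2 B.\<close>
    define g where "g n = (if n = 0 then 0 else (c n * of_real (b n)) *\<^sub>C \<phi> (n - 1))" for n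
    define h where "h n = (c n * of_real (b (Suc n))) *\<^sub>C \<phi> (Suc n)" for n
    have gh: "c n *\<^sub>C T (\<phi> n) = g n + h n" for n
      by (simp add: T\<phi> g_def h_def scaleC_add_right scaleC_scaleC)
    have g: "summable (\<lambda>n. g (Suc n))" "norm (\<Sum>n. g (Suc n)) \<le> B * norm u"
      using orthonormal_weighted_sum[OF on c' cle', of "\<lambda>n. b (Suc n)" B] b by (simp_all add: g_def)
    have g': "summable g" "suminf g = (\<Sum>n. g (Suc n))"
      using g(1)[unfolded summable_Suc_iff] suminf_split_head[of g] by (simp_all add: g_def[of 0])
    have h: "summable h" "norm (suminf h) \<le> B * norm u"
      unfolding h_def using orthonormal_weighted_sum[OF on' c cle, of "\<lambda>n. b (Suc n)" B] b by simp_all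
    define w where "w = suminf g + suminf h"
    have TSw: "(\<lambda>N. T (S N)) \<longlonglongrightarrow> w"
      unfolding TS gh w_def sums_def[symmetric] using g'(1) h(1) by (intro sums_add summable_sums)
    have "norm w \<le> 2 * B * norm u"
      unfolding w_def g'(2) using norm_triangle_le[OF add_mono[OF g(2) h(2)]] by simp
    moreover have "cinner (T v) u = cinner v w" if "v \<in> D" for v
    proof (rule LIMSEQ_unique)
      show "(\<lambda>N. cinner (T v) (S N)) \<longlonglongrightarrow> cinner (T v) u"
        by (intro cinner.tendsto tendsto_const Su)
      have "cinner (T v) (S N) = cinner v (T (S N))" for N
        using adj[of "S N" "T (S N)"] SD that by blast
      then show "(\<lambda>N. cinner (T v) (S N)) \<longlonglongrightarrow> cinner v w"
        by (simp add: cinner.tendsto[OF tendsto_const TSw])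
    qed
    ultimately show ?thesis
      using adj[of u w] by blast
  qed
  then show "D = UNIV" "norm (T u) \<le> 2 * B * norm u" by auto
qed

section \<open>Spectral measures of bounded operators\<close>

text \<open>Polarization writes 4 <A u, w> as a difference of two values of the quadratic form; the
  parallelogram law bounds it by 2 e (|u|^2 + |w|^2).\<close>

lemma symmetric_norm_le:
  fixes A :: "'h::real_inner \<Rightarrow> 'h"
  assumes lin: "linear A" and sym: "\<And>u v. inner (A u) v = inner u (A v)"
    and bd: "\<And>v. \<bar>inner v (A v)\<bar> \<le> e * (norm v)\<^sup>2"
  shows "norm (A u) \<le> e * norm u"
proof (cases "A u = 0 \<or> u = 0")
  case True
  have "0 \<le> e * norm u"
  proof (cases "u = 0")
    case False
    have "0 \<le> e * (norm u)\<^sup>2" using bd[of u] by (meson abs_ge_zero order_trans)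
    then show ?thesis using False by (simp add: zero_le_mult_iff)
  qed simp
  then show ?thesis using True linear_0[OF lin] by auto
next
  case False
  \<comment> \<open>A u rescaled to the length of u, which makes <A u, w> equal to |u| |A u| and
    balances the two squares.\<close>
  define w where "w = (norm u / norm (A u)) *\<^sub>R A u"
  have nw: "norm w = norm u" using False by (simp add: w_def)
  have Auw: "inner (A u) w = norm u * norm (A u)"
    using False by (simp add: w_def power2_norm_eq_inner[symmetric] power2_eq_square)
  have "4 * inner (A u) w = inner (u + w) (A (u + w)) - inner (u - w) (A (u - w))"
    using sym[of u w] by (simp add: linear_add[OF lin] linear_diff[OF lin] inner_add_left inner_add_right inner_diff_left inner_diff_right inner_commute)
  also have "\<dots> \<le> e * ((norm (u + w))\<^sup>2 + (norm (u - w))\<^sup>2)"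
    using bd[of "u + w"] bd[of "u - w"] by (simp add: distrib_left abs_le_iff)
  also have "(norm (u + w))\<^sup>2 + (norm (u - w))\<^sup>2 = 4 * (norm u)\<^sup>2"
    using nw by (simp add: power2_norm_eq_inner inner_add_left inner_add_right inner_diff_left inner_diff_right norm_eq)
  finally have "norm u * norm (A u) \<le> norm u * (e * norm u)"
    by (simp add: Auw power2_eq_square mult_ac)
  then show ?thesis using False by simp
qed

lemma (in finite_measure) AE_in_of_measure_eq:
  assumes "A \<in> sets M" "measure M A = measure M (space M)"
  shows "AE x in M. x \<in> A"
proof (rule AE_I')
  show "space M - A \<in> null_sets M"
    using assms finite_measure_compl[OF assms(1)] by (auto simp: null_sets_def emeasure_eq_measure)
qed auto

text \<open>A real inner product suffices, since only real parts of the form enter.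
  \<open>T_form\<close> is the sole assumption connecting \<open>T\<close> with
  \<open>E\<close>.\<close>

locale spectral_resolution =
  fixes T :: "'h::real_inner \<Rightarrow> 'h" and E :: "real \<Rightarrow> 'h \<Rightarrow> 'h" and M :: real
  assumes T_lin: "linear T" and T_sym: "inner (T u) v = inner u (T v)"
    and T_bound: "norm (T u) \<le> M * norm u"
    and E_lin: "linear (E x)" and E_sym: "inner (E x u) v = inner u (E x v)"
    and E_min: "E x (E y u) = E (min x y) u"
    and E_right: "((\<lambda>y. E y u) \<longlongrightarrow> E x u) (at_right x)"
    and E_bot: "((\<lambda>y. E y u) \<longlongrightarrow> 0) at_bot"
    and E_top: "((\<lambda>y. E y u) \<longlongrightarrow> u) at_top"
    and square_integrable: "integrable (interval_measure (\<lambda>x. inner u (E x u))) (\<lambda>x. x\<^sup>2)"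
    and T_form: "inner u (T u) = (\<integral>x. x \<partial>interval_measure (\<lambda>x. inner u (E x u)))"
begin

abbreviation distr_at :: "'h \<Rightarrow> real measure" where
  "distr_at u \<equiv> interval_measure (\<lambda>x. inner u (E x u))"

lemma inner_E: "inner u (E x u) = (norm (E x u))\<^sup>2"
  by (simp add: power2_norm_eq_inner E_sym E_min)

lemma norm_E_le: "norm (E x u) \<le> norm u"
proof (cases "E x u = 0")
  case False
  have "norm (E x u) * norm (E x u) \<le> norm u * norm (E x u)"
    using norm_cauchy_schwarz[of u "E x u"] by (simp add: inner_E power2_eq_square)
  then show ?thesis using False by simp
qed simp

lemma inner_E_mono: "x \<le> y \<Longrightarrow> inner u (E x u) \<le> inner u (E y u)"
  using norm_E_le[of x "E y u"] by (simp add: inner_E E_min power_mono)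

lemma inner_E_cont: "continuous (at_right x) (\<lambda>x. inner u (E x u))"
  unfolding continuous_within by (intro tendsto_intros E_right)

lemma inner_E_bot: "((\<lambda>x. inner u (E x u)) \<longlongrightarrow> 0) at_bot"
  using tendsto_inner[OF tendsto_const E_bot, of u u] by simp

lemma inner_E_top: "((\<lambda>x. inner u (E x u)) \<longlongrightarrow> (norm u)\<^sup>2) at_top"
  using tendsto_inner[OF tendsto_const E_top, of u u] by (simp add: power2_norm_eq_inner)

lemma finite_borel_measure_distr_at: "finite_borel_measure (distr_at u)"
  by (rule finite_borel_measure_interval_measure[OF inner_E_mono inner_E_cont inner_E_bot inner_E_top]) auto

lemma finite_measure_distr_at: "finite_measure (distr_at u)"
  using finite_borel_measure_distr_at finite_borel_measure.axioms(1) by blast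

lemma measure_distr_at_UNIV: "measure (distr_at u) UNIV = (norm u)\<^sup>2"
  using interval_measure_UNIV[OF inner_E_mono inner_E_cont inner_E_bot inner_E_top, of u] by (simp add: measure_def)

lemma measure_distr_at_Iic: "measure (distr_at u) {..x} = inner u (E x u)"
  by (rule measure_interval_measure_Iic[OF inner_E_mono inner_E_cont inner_E_bot])

lemma measure_distr_at_Ioc: "x \<le> y \<Longrightarrow> measure (distr_at u) {x<..y} = inner u (E y u) - inner u (E x u)"
  by (rule measure_interval_measure_Ioc[OF _ inner_E_mono inner_E_cont])

lemma integrable_distr_at_ident: "integrable (distr_at u) (\<lambda>x. x)"
  using finite_measure.square_integrable_imp_integrable[OF finite_measure_distr_at _ square_integrable] by simp

lemma integral_distr_at_const: "(\<integral>x. c \<partial>distr_at u) = c * (norm u)\<^sup>2" for c :: real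
  by (simp add: measure_distr_at_UNIV)

lemma abs_inner_T_le: "\<bar>inner u (T u)\<bar> \<le> M * (norm u)\<^sup>2"
proof -
  have "\<bar>inner u (T u)\<bar> \<le> norm u * norm (T u)" by (rule Cauchy_Schwarz_ineq2)
  also have "\<dots> \<le> norm u * (M * norm u)" by (intro mult_left_mono T_bound) auto
  finally show ?thesis by (simp add: power2_eq_square mult_ac)
qed

text \<open>The distribution of w = u - E_y u lives on (y, \<infinity>), so y |w|^2 \<le> <w, T w>
  \<le> M |w|^2, which forces w = 0 when y > M.\<close>

lemma E_above:
  assumes "M < y" shows "E y u = u"
proof -
  define w where "w = u - E y u"
  have "E y w = 0"
    by (simp add: w_def linear_diff[OF E_lin] E_min)
  then have "measure (distr_at w) {..y} = 0"
    by (simp add: measure_distr_at_Iic)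
  then have "AE x in distr_at w. x \<in> - {..y}"
    using finite_measure.finite_measure_compl[OF finite_measure_distr_at, of "{..y}" w]
    by (intro finite_measure.AE_in_of_measure_eq[OF finite_measure_distr_at]) (auto simp: Compl_eq_Diff_UNIV)
  then have "(\<integral>x. y \<partial>distr_at w) \<le> (\<integral>x. x \<partial>distr_at w)"
    by (intro integral_mono_AE integrable_distr_at_ident finite_measure.integrable_const finite_measure_distr_at) auto
  then have "y * (norm w)\<^sup>2 \<le> M * (norm w)\<^sup>2"
    using abs_inner_T_le[of w] unfolding integral_distr_at_const T_form by linarith
  then have "w = 0" using assms by (simp add: mult_le_cancel_right)
  then show ?thesis by (simp add: w_def)
qed

text \<open>Mirror image: w = E_y u has its distribution on (-\<infinity>, y], so -M |w|^2 \<le> <w,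
  T w> \<le> y |w|^2.\<close>

lemma E_below:
  assumes "y < - M" shows "E y u = 0"
proof -
  define w where "w = E y u"
  have "E y w = w"
    by (simp add: w_def E_min)
  then have "measure (distr_at w) {..y} = (norm w)\<^sup>2"
    by (simp add: measure_distr_at_Iic power2_norm_eq_inner)
  then have "AE x in distr_at w. x \<in> {..y}"
    by (intro finite_measure.AE_in_of_measure_eq[OF finite_measure_distr_at]) (auto simp: measure_distr_at_UNIV)
  then have "(\<integral>x. x \<partial>distr_at w) \<le> (\<integral>x. y \<partial>distr_at w)"
    by (intro integral_mono_AE integrable_distr_at_ident finite_measure.integrable_const finite_measure_distr_at) auto
  then have "- (M * (norm w)\<^sup>2) \<le> y * (norm w)\<^sup>2"
    using abs_inner_T_le[of w] unfolding integral_distr_at_const T_form by linarith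
  then have "- M * (norm w)\<^sup>2 \<le> y * (norm w)\<^sup>2" by simp
  then have "w = 0" using assms by (subst (asm) mult_le_cancel_right) auto
  then show ?thesis by (simp add: w_def)
qed

text \<open>An integer strictly beyond the spectral bound: grids of mesh 1/N starting at -K then
  reach K exactly after 2 K N cells.\<close>

definition K :: nat where "K = nat \<lceil>M\<rceil> + 1"

lemma K: "M < real K" "- real K < - M" "1 \<le> K"
  unfolding K_def by linarith+

lemma AE_distr_at: "AE x in distr_at u. x \<in> {- real K<..real K}"
  by (intro finite_measure.AE_in_of_measure_eq[OF finite_measure_distr_at])
     (auto simp: measure_distr_at_UNIV measure_distr_at_Ioc E_above E_below K power2_norm_eq_inner)

section \<open>Riemann sums of the spectral integral\<close>

definition node :: "nat \<Rightarrow> nat \<Rightarrow> real" where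
  "node N k = real k / real N - real K"

definition jump :: "nat \<Rightarrow> nat \<Rightarrow> 'h \<Rightarrow> 'h" where
  "jump N k v = E (node N (Suc k)) v - E (node N k) v"

text \<open>The spectral integral of the step function h(\<open>cell N\<close> x), that is, a
  Riemann sum for the integral of h dE.\<close>

definition step :: "nat \<Rightarrow> (real \<Rightarrow> real) \<Rightarrow> 'h \<Rightarrow> 'h" where
  "step N h v = (\<Sum>k<2 * K * N. h (node N k) *\<^sub>R jump N k v)"

text \<open>The left end of the cell containing x. Cells are open on the left, matching the
  right-continuity of \<open>E\<close>, so the index is a ceiling minus 1.\<close>

definition cell :: "nat \<Rightarrow> real \<Rightarrow> real" where
  "cell N x = node N (nat (\<lceil>(x + real K) * real N\<rceil> - 1))"

lemma node_mono: "i \<le> j \<Longrightarrow> node N i \<le> node N j"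
  by (simp add: node_def divide_right_mono)

lemma linear_jump: "linear (jump N k)"
  unfolding jump_def by (intro linear_compose_sub E_lin)

lemma jump_sym: "inner (jump N k u) v = inner u (jump N k v)"
  by (simp add: jump_def inner_diff_left inner_diff_right E_sym)

text \<open>Projections onto disjoint intervals are orthogonal; every composition reduces through
  E_x E_y = E_min(x,y).\<close>

lemma jump_jump: "jump N i (jump N j v) = (if i = j then jump N j v else 0)"
proof -
  have "jump N i (jump N j v) = 0" if "i < j"
    using node_mono[of i j N] node_mono[of "Suc i" j N] node_mono[of i "Suc j" N] node_mono[of "Suc i" "Suc j" N] that
    by (simp add: jump_def linear_diff[OF E_lin] E_min min_absorb1)
  moreover have "jump N i (jump N j v) = 0" if "j < i"
    using node_mono[of j i N] node_mono[of "Suc j" i N] node_mono[of j "Suc i" N] node_mono[of "Suc j" "Suc i" N] that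
    by (simp add: jump_def linear_diff[OF E_lin] E_min min_absorb2)
  moreover have "jump N j (jump N j v) = jump N j v"
    using node_mono[of j "Suc j" N]
    by (simp add: jump_def linear_diff[OF E_lin] E_min min_absorb2 min_absorb1)
  ultimately show ?thesis by (metis nat_neq_iff)
qed

lemma linear_step: "linear (step N h)"
  unfolding step_def by (intro linear_compose_sum ballI linear_compose_scale_right linear_jump)

lemma step_sym: "inner (step N h u) v = inner u (step N h v)"
  by (simp add: step_def inner_sum_left inner_sum_right jump_sym)

text \<open>Orthogonality of the jumps removes the cross terms. This multiplicativity turns a
  product x P(x) of functions into a composition of operators.\<close>

lemma step_step: "step N h (step N g v) = step N (\<lambda>x. h x * g x) v"
proof -
  have "jump N k (step N g v) = g (node N k) *\<^sub>R jump N k v" if "k < 2 * K * N" for k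
    using that
    by (simp add: step_def linear_sum[OF linear_jump] linear_scale[OF linear_jump] jump_jump if_distrib cong: if_cong)
  then show ?thesis
    by (simp add: step_def[of N h] step_def[of N "\<lambda>x. h x * g x"])
qed

lemma step_const_1:
  assumes "N \<ge> 1" shows "step N (\<lambda>x. 1) v = v"
proof -
  have "step N (\<lambda>x. 1) v = E (node N (2 * K * N)) v - E (node N 0) v"
    unfolding step_def jump_def scaleR_one by (rule sum_lessThan_telescope)
  moreover have "node N (2 * K * N) = real K" "node N 0 = - real K"
    using assms by (simp_all add: node_def)
  ultimately show ?thesis using E_above[OF K(1)] E_below[OF K(2)] by simp
qed

lemma step_linear_combination:
  "step N (\<lambda>x. c * f x - d * g x) v = c *\<^sub>R step N f v - d *\<^sub>R step N g v"
  by (simp add: step_def scaleR_diff_left sum_subtractf scaleR_sum_right)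

lemma cell_eq_sum:
  fixes h :: "real \<Rightarrow> real"
  assumes N: "N \<ge> 1" and x: "x \<in> {- real K<..real K}"
  shows "h (cell N x) = (\<Sum>k<2 * K * N. h (node N k) * indicator {node N k<..node N (Suc k)} x)"
    and "cell N x \<le> x" "x - 1 / N \<le> cell N x" "cell N x \<in> {- real K..real K}"
proof -
  define y where "y = (x + real K) * real N"
  define k where "k = nat (\<lceil>y\<rceil> - 1)"
  have y0: "0 < y" and yK: "y \<le> 2 * K * N"
    using N x by (auto simp: y_def intro!: mult_right_mono)
  have "0 < \<lceil>y\<rceil>" using y0 by simp
  then have ky: "real k < y" "y \<le> real k + 1"
    unfolding k_def by linarith+
  \<comment> \<open>The cells are disjoint, so exactly one indicator in the sum is nonzero, that of
    index k.\<close>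
  have mem: "x \<in> {node N j<..node N (Suc j)} \<longleftrightarrow> j = k" for j
  proof -
    have "x \<in> {node N j<..node N (Suc j)} \<longleftrightarrow> real j < y \<and> y \<le> real j + 1"
      using N by (simp add: node_def y_def field_simps)
    also have "\<dots> \<longleftrightarrow> j = k" using ky by linarith
    finally show ?thesis .
  qed
  have c: "cell N x = node N k" by (simp add: cell_def k_def y_def)
  have "real k < real (2 * K * N)" using ky yK by simp
  then have k: "k < 2 * K * N" by linarith
  have "(\<Sum>j<2 * K * N. h (node N j) * indicator {node N j<..node N (Suc j)} x) = (\<Sum>j<2 * K * N. if j = k then h (node N j) else 0)"
    unfolding indicator_def of_bool_def mem by (intro sum.cong) auto
  then show "h (cell N x) = (\<Sum>k<2 * K * N. h (node N k) * indicator {node N k<..node N (Suc k)} x)"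
    using k by (simp add: c)
  have m: "node N k < x" "x \<le> node N (Suc k)" using mem[of k] by auto
  then show "cell N x \<le> x" by (simp add: c)
  show "x - 1 / N \<le> cell N x" using m(2) by (simp add: c node_def add_divide_distrib)
  have "- real K \<le> node N k" by (simp add: node_def)
  then show "cell N x \<in> {- real K..real K}" using m(1) x by (auto simp: c)
qed

lemma borel_measurable_cell [measurable]: "cell N \<in> borel_measurable borel"
proof -
  have "(\<lambda>i::int. node N (nat (i - 1))) \<in> measurable (count_space UNIV) borel" by simp
  from measurable_compose[OF _ this, of "\<lambda>x. \<lceil>(x + real K) * real N\<rceil>"]
  show ?thesis unfolding cell_def[abs_def] by simp
qed

text \<open>Almost everywhere h(\<open>cell N\<close> x) is a finite combination of indicators of
  cells, and the measure of cell k is <u, jump_k u>.\<close>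

lemma inner_step:
  assumes N: "N \<ge> 1" and [measurable]: "h \<in> borel_measurable borel"
  shows "inner u (step N h u) = (\<integral>x. h (cell N x) \<partial>distr_at u)"
proof -
  interpret finite_measure "distr_at u" by (rule finite_measure_distr_at)
  have "(\<integral>x. h (cell N x) \<partial>distr_at u) = (\<integral>x. (\<Sum>k<2 * K * N. h (node N k) * indicator {node N k<..node N (Suc k)} x) \<partial>distr_at u)"
  proof (rule integral_cong_AE)
    show "AE x in distr_at u. h (cell N x) = (\<Sum>k<2 * K * N. h (node N k) * indicator {node N k<..node N (Suc k)} x)"
      using AE_distr_at[of u] by eventually_elim (rule cell_eq_sum(1)[OF N])
  qed measurable
  also have "\<dots> = (\<Sum>k<2 * K * N. (\<integral>x. h (node N k) * indicator {node N k<..node N (Suc k)} x \<partial>distr_at u))"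
    by (rule Bochner_Integration.integral_sum) (auto intro!: integrable_real_mult_indicator simp: less_top[symmetric])
  also have "\<dots> = (\<Sum>k<2 * K * N. h (node N k) * inner u (jump N k u))"
    by (simp add: measure_distr_at_Ioc node_mono jump_def inner_diff_right)
  also have "\<dots> = inner u (step N h u)"
    by (simp add: step_def inner_sum_right)
  finally show ?thesis by simp
qed

text \<open>The forms of both operators are integrals, of \<open>cell N\<close> x and of x, whose
  integrands differ by at most 1/N. Symmetry lifts this from the form to the norm.\<close>

lemma norm_step_minus_T_le:
  assumes N: "N \<ge> 1"
  shows "norm (step N (\<lambda>x. x) v - T v) \<le> 1 / N * norm v"
proof (rule symmetric_norm_le)
  show "linear (\<lambda>v. step N (\<lambda>x. x) v - T v)"
    by (intro linear_compose_sub linear_step T_lin)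
  show "inner (step N (\<lambda>x. x) u - T u) v = inner u (step N (\<lambda>x. x) v - T v)" for u v
    by (simp add: inner_diff_left inner_diff_right step_sym T_sym)
  fix u
  interpret finite_measure "distr_at u" by (rule finite_measure_distr_at)
  have bd: "AE x in distr_at u. norm (cell N x - x) \<le> 1 / N"
    using AE_distr_at[of u] by eventually_elim (use cell_eq_sum(2,3)[OF N] in force)
  have int: "integrable (distr_at u) (\<lambda>x. cell N x - x)"
    by (rule integrable_const_bound[OF bd]) simp
  have "inner u (step N (\<lambda>x. x) u) = (\<integral>x. (cell N x - x) + x \<partial>distr_at u)"
    by (subst inner_step[OF N]) auto
  also have "\<dots> = (\<integral>x. cell N x - x \<partial>distr_at u) + inner u (T u)"
    unfolding T_form by (rule Bochner_Integration.integral_add[OF int integrable_distr_at_ident])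
  finally have "\<bar>inner u (step N (\<lambda>x. x) u - T u)\<bar> = \<bar>\<integral>x. cell N x - x \<partial>distr_at u\<bar>"
    by (simp add: inner_diff_right)
  also have "\<dots> \<le> (\<integral>x. \<bar>cell N x - x\<bar> \<partial>distr_at u)"
    by (rule integral_abs_bound)
  also have "\<dots> \<le> (\<integral>x. 1 / N \<partial>distr_at u)"
    using bd int by (intro integral_mono_AE) auto
  finally show "\<bar>inner u (step N (\<lambda>x. x) u - T u)\<bar> \<le> 1 / real N * (norm u)\<^sup>2"
    unfolding integral_distr_at_const .
qed

text \<open>The vector varies with N because this is iterated: the argument will itself be a Riemann
  sum on the same grid.\<close>

lemma tendsto_step_T:
  assumes "v \<longlonglongrightarrow> w"
  shows "(\<lambda>N. step N (\<lambda>x. x) (v N)) \<longlonglongrightarrow> T w"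
proof -
  have "(\<lambda>N. step N (\<lambda>x. x) (v N) - T w) \<longlonglongrightarrow> 0"
  proof (rule Lim_null_comparison)
    show "\<forall>\<^sub>F N in sequentially. norm (step N (\<lambda>x. x) (v N) - T w) \<le> 1 / real N * norm (v N) + M * norm (v N - w)"
      using eventually_ge_at_top[of 1]
    proof eventually_elim
      case (elim N)
      have "step N (\<lambda>x. x) (v N) - T w = (step N (\<lambda>x. x) (v N) - T (v N)) + T (v N - w)"
        by (simp add: linear_diff[OF T_lin])
      also have "norm \<dots> \<le> 1 / real N * norm (v N) + M * norm (v N - w)"
        by (intro norm_triangle_le add_mono norm_step_minus_T_le elim T_bound)
      finally show ?case .
    qed
    have "(\<lambda>N. 1 / real N * norm (v N) + M * norm (v N - w)) \<longlonglongrightarrow> 0 * norm w + M * norm (w - w)"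
      by (intro tendsto_intros assms lim_1_over_n)
    then show "(\<lambda>N. 1 / real N * norm (v N) + M * norm (v N - w)) \<longlonglongrightarrow> 0" by simp
  qed
  then show ?thesis by (simp add: LIM_zero_iff)
qed

lemma tendsto_integral_cell:
  fixes h :: "real \<Rightarrow> real"
  assumes h: "continuous_on UNIV h"
  shows "(\<lambda>N. \<integral>x. h (cell N x) \<partial>distr_at u) \<longlonglongrightarrow> (\<integral>x. h x \<partial>distr_at u)"
proof -
  interpret finite_measure "distr_at u" by (rule finite_measure_distr_at)
  have [measurable]: "h \<in> borel_measurable borel" using h by (rule borel_measurable_continuous_onI)
  have "compact (h ` {- real K..real K})"
    by (intro compact_continuous_image continuous_on_subset[OF h]) auto
  then obtain B where B: "norm (h x) \<le> B" if "x \<in> {- real K..real K}" for x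
    by (meson bounded_iff compact_imp_bounded imageI)
  \<comment> \<open>Dominated convergence along N + 1, because \<open>cell\<close> approximates x
    only for positive N.\<close>
  have "(\<lambda>N. \<integral>x. h (cell (Suc N) x) \<partial>distr_at u) \<longlonglongrightarrow> (\<integral>x. h x \<partial>distr_at u)"
  proof (rule Bochner_Integration.integral_dominated_convergence[where w="\<lambda>_. B"])
    show "AE x in distr_at u. (\<lambda>N. h (cell (Suc N) x)) \<longlonglongrightarrow> h x"
      using AE_distr_at[of u]
    proof eventually_elim
      case (elim x)
      have "(\<lambda>N. cell (Suc N) x) \<longlonglongrightarrow> x"
      proof (rule tendsto_sandwich)
        have "(\<lambda>N. x - 1 / real (Suc N)) \<longlonglongrightarrow> x - 0"
          by (intro tendsto_diff tendsto_const LIMSEQ_Suc[OF lim_1_over_n])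
        then show "(\<lambda>N. x - 1 / real (Suc N)) \<longlonglongrightarrow> x" by simp
        show "\<forall>\<^sub>F N in sequentially. x - 1 / real (Suc N) \<le> cell (Suc N) x"
          by (intro always_eventually allI cell_eq_sum(3)[OF _ elim]) simp
        show "\<forall>\<^sub>F N in sequentially. cell (Suc N) x \<le> x"
          by (intro always_eventually allI cell_eq_sum(2)[OF _ elim]) simp
      qed simp
      then show ?case
        using h continuous_on_tendsto_compose[OF h] by simp
    qed
    show "AE x in distr_at u. norm (h (cell (Suc N) x)) \<le> B" for N
      using AE_distr_at[of u] by eventually_elim (use cell_eq_sum(4) B in force)
  qed auto
  then show ?thesis by (rule LIMSEQ_imp_Suc)
qed

text \<open>Multiplication by x acts on P_n as \<open>T\<close> acts on \<phi>_n, so the Riemann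
  sums of P_n applied to \<phi>_0 tend to \<phi>_n. The inner product of two of them is the integral
  of the step function of P_m P_n, and both expressions converge.\<close>

lemma integral_mult_orthogonal_polynomials:
  fixes \<phi> :: "nat \<Rightarrow> 'h" and P :: "nat \<Rightarrow> real \<Rightarrow> real" and b :: "nat \<Rightarrow> real"
  assumes P0: "P 0 = (\<lambda>x. 1)" and P_cont: "\<And>n. continuous_on UNIV (P n)"
    and b: "\<And>n. 0 < b (Suc n)"
    and P_rec: "\<And>n x. x * P n x = (if n = 0 then 0 else b n * P (n - 1) x) + b (Suc n) * P (Suc n) x"
    and T_\<phi>: "\<And>n. T (\<phi> n) = (if n = 0 then 0 else b n *\<^sub>R \<phi> (n - 1)) + b (Suc n) *\<^sub>R \<phi> (Suc n)"
  shows "(\<integral>x. P m x * P n x \<partial>distr_at (\<phi> 0)) = inner (\<phi> m) (\<phi> n)"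
proof -
  have lim: "(\<lambda>N. step N (P n) (\<phi> 0)) \<longlonglongrightarrow> \<phi> n" for n
  proof (induction n rule: less_induct)
    case (less n)
    show ?case
    proof (cases n)
      case 0
      have "\<forall>\<^sub>F N in sequentially. step N (P n) (\<phi> 0) = \<phi> n"
        using eventually_ge_at_top[of 1] by eventually_elim (simp add: 0 P0 step_const_1)
      then show ?thesis by (rule tendsto_eventually)
    next
      case (Suc m)
      \<comment> \<open>Zero for m = 0, where the recurrence has no lower term and m - 1 is
        truncated.\<close>
      define d where "d = (if m = 0 then 0 else b m / b n)"
      have Pn: "P n = (\<lambda>x. 1 / b n * (x * P m x) - d * P (m - 1) x)"
        using P_rec[of _ m] b[of m] by (auto simp: Suc d_def field_simps)
      have \<phi>n: "\<phi> n = (1 / b n) *\<^sub>R T (\<phi> m) - d *\<^sub>R \<phi> (m - 1)"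
        using T_\<phi>[of m] b[of m] by (simp add: Suc d_def scaleR_add_right)
      have "step N (P n) (\<phi> 0) = (1 / b n) *\<^sub>R step N (\<lambda>x. x) (step N (P m) (\<phi> 0)) - d *\<^sub>R step N (P (m - 1)) (\<phi> 0)" for N
        unfolding Pn step_linear_combination step_step ..
      moreover have "(\<lambda>N. (1 / b n) *\<^sub>R step N (\<lambda>x. x) (step N (P m) (\<phi> 0)) - d *\<^sub>R step N (P (m - 1)) (\<phi> 0)) \<longlonglongrightarrow> \<phi> n"
        unfolding \<phi>n by (intro tendsto_intros tendsto_step_T less) (auto simp: Suc)
      ultimately show ?thesis by simp
    qed
  qed
  have cont: "continuous_on UNIV (\<lambda>x. P m x * P n x)"
    by (intro continuous_on_mult P_cont)
  have ev: "\<forall>\<^sub>F N in sequentially. (\<integral>x. P m (cell N x) * P n (cell N x) \<partial>distr_at (\<phi> 0)) = inner (step N (P m) (\<phi> 0)) (step N (P n) (\<phi> 0))"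
    using eventually_ge_at_top[of 1]
  proof eventually_elim
    case (elim N)
    then show ?case
      using inner_step[OF elim borel_measurable_continuous_onI[OF cont], of "\<phi> 0"]
      by (simp add: step_sym step_step)
  qed
  then have "(\<lambda>N. \<integral>x. P m (cell N x) * P n (cell N x) \<partial>distr_at (\<phi> 0)) \<longlonglongrightarrow> inner (\<phi> m) (\<phi> n)"
    using tendsto_inner[OF lim lim] by (subst tendsto_cong[OF ev])
  then show ?thesis
    using tendsto_integral_cell[OF cont, of "\<phi> 0"] LIMSEQ_unique by blast
qed

end

section \<open>Square-integrable functions\<close>

lemma Cauchy_Schwarz_integral:
  fixes f g :: "'a \<Rightarrow> real"
  assumes [measurable]: "f \<in> borel_measurable M" "g \<in> borel_measurable M"
    and f2: "integrable M (\<lambda>x. (f x)\<^sup>2)" and g2: "integrable M (\<lambda>x. (g x)\<^sup>2)"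
  shows "integrable M (\<lambda>x. f x * g x)"
    and "(\<integral>x. f x * g x \<partial>M)\<^sup>2 \<le> (\<integral>x. (f x)\<^sup>2 \<partial>M) * (\<integral>x. (g x)\<^sup>2 \<partial>M)"
proof -
  have "\<bar>s * t\<bar> \<le> s\<^sup>2 + t\<^sup>2" for s t :: real
    using sum_squares_bound[of "\<bar>s\<bar>" "\<bar>t\<bar>"] mult_nonneg_nonneg[OF abs_ge_zero abs_ge_zero, of s t]
    unfolding abs_mult power2_abs by linarith
  then show fg: "integrable M (\<lambda>x. f x * g x)"
    by (intro Bochner_Integration.integrable_bound[OF Bochner_Integration.integrable_add[OF f2 g2]]) auto
  define A B C where "A = (\<integral>x. (f x)\<^sup>2 \<partial>M)" and "B = (\<integral>x. f x * g x \<partial>M)" and "C = (\<integral>x. (g x)\<^sup>2 \<partial>M)"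
  have C0: "C \<ge> 0" by (simp add: C_def)
  \<comment> \<open>A quadratic in t that is nowhere negative; its minimum at t = B/C yields the
    inequality.\<close>
  have pos: "0 \<le> A - 2 * t * B + t\<^sup>2 * C" for t
  proof -
    have "0 \<le> (\<integral>x. (f x - t * g x)\<^sup>2 \<partial>M)" by simp
    also have "\<dots> = (\<integral>x. (f x)\<^sup>2 - 2 * t * (f x * g x) + t\<^sup>2 * (g x)\<^sup>2 \<partial>M)"
      by (rule arg_cong[where f="integral\<^sup>L M"]) (simp add: fun_eq_iff power2_eq_square algebra_simps)
    also have "\<dots> = A - 2 * t * B + t\<^sup>2 * C"
      using f2 g2 fg by (simp add: A_def B_def C_def)
    finally show ?thesis .
  qed
  have "B\<^sup>2 \<le> A * C"
  proof (cases "C = 0")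
    case True
    have "B = 0"
    proof (rule ccontr)
      assume "B \<noteq> 0"
      \<comment> \<open>If C = 0 the quadratic is affine in t, and this t gives it the value
        -1.\<close>
      then have "2 * ((A + 1) / (2 * B)) * B = A + 1" by simp
      then show False using pos[of "(A + 1) / (2 * B)"] unfolding True by linarith
    qed
    then show ?thesis using True by simp
  next
    case False
    have "A - 2 * (B / C) * B + (B / C)\<^sup>2 * C = A - B\<^sup>2 / C"
      using False by (simp add: power2_eq_square)
    then have "B\<^sup>2 / C \<le> A" using pos[of "B / C"] by linarith
    then show ?thesis using C0 False by (simp add: pos_divide_le_eq)
  qed
  then show "(\<integral>x. f x * g x \<partial>M)\<^sup>2 \<le> (\<integral>x. (f x)\<^sup>2 \<partial>M) * (\<integral>x. (g x)\<^sup>2 \<partial>M)"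
    by (simp add: A_def B_def C_def)
qed

lemma L2D:
  assumes "f \<in> L2 M"
  shows "f \<in> borel_measurable M" "integrable M (\<lambda>x. (cmod (f x))\<^sup>2)"
  using assms unfolding L2_def by blast+

lemma L2_add: "f \<in> L2 M \<Longrightarrow> g \<in> L2 M \<Longrightarrow> (\<lambda>x. f x + g x) \<in> L2 M"
proof -
  assume f: "f \<in> L2 M" and g: "g \<in> L2 M"
  note [measurable] = L2D(1)[OF f] L2D(1)[OF g]
  have "(cmod (a + b))\<^sup>2 \<le> 2 * (cmod a)\<^sup>2 + 2 * (cmod b)\<^sup>2" for a b
  proof -
    have "(cmod (a + b))\<^sup>2 \<le> (cmod a + cmod b)\<^sup>2" by (intro power_mono norm_triangle_ineq) simp
    also have "\<dots> \<le> 2 * (cmod a)\<^sup>2 + 2 * (cmod b)\<^sup>2"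
      using sum_squares_bound[of "cmod a" "cmod b"] by (simp add: power2_sum)
    finally show ?thesis .
  qed
  then have le: "norm ((cmod (f x + g x))\<^sup>2) \<le> norm (2 * (cmod (f x))\<^sup>2 + 2 * (cmod (g x))\<^sup>2)" for x
    by (metis abs_ge_self abs_of_nonneg order_trans real_norm_def zero_le_power2)
  have "integrable M (\<lambda>x. (cmod (f x + g x))\<^sup>2)"
  proof (rule Bochner_Integration.integrable_bound[OF _ _ AE_I2[OF le]])
    show "integrable M (\<lambda>x. 2 * (cmod (f x))\<^sup>2 + 2 * (cmod (g x))\<^sup>2)"
      using L2D(2)[OF f] L2D(2)[OF g] by simp
  qed measurable
  then show ?thesis by (simp add: L2_def)
qed

lemma L2_mult_const:
  assumes "f \<in> L2 M" shows "(\<lambda>x. c * f x) \<in> L2 M"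
proof -
  note [measurable] = L2D(1)[OF assms]
  have "integrable M (\<lambda>x. (cmod c)\<^sup>2 * (cmod (f x))\<^sup>2)"
    using L2D(2)[OF assms] by simp
  then show ?thesis by (simp add: L2_def norm_mult power_mult_distrib)
qed

lemma L2_diff: "f \<in> L2 M \<Longrightarrow> g \<in> L2 M \<Longrightarrow> (\<lambda>x. f x - g x) \<in> L2 M"
  using L2_add[of f M "\<lambda>x. - 1 * g x"] L2_mult_const[of g M "- 1"] by simp

lemma L2_zero: "(\<lambda>x. 0) \<in> L2 M"
  by (simp add: L2_def)

lemma L2_sum: "(\<And>i. i \<in> I \<Longrightarrow> f i \<in> L2 M) \<Longrightarrow> (\<lambda>x. \<Sum>i\<in>I. f i x) \<in> L2 M"
  by (induction I rule: infinite_finite_induct) (auto simp: L2_zero L2_add)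

lemma L2_cnj_mult:
  assumes "f \<in> L2 M" "g \<in> L2 M"
  shows "integrable M (\<lambda>x. cnj (f x) * g x)"
    and "(cmod (\<integral>x. cnj (f x) * g x \<partial>M))\<^sup>2 \<le> (\<integral>x. (cmod (f x))\<^sup>2 \<partial>M) * (\<integral>x. (cmod (g x))\<^sup>2 \<partial>M)"
proof -
  note [measurable] = L2D(1)[OF assms(1)] L2D(1)[OF assms(2)]
  have [measurable]: "cnj \<in> borel_measurable borel"
    by (intro borel_measurable_continuous_onI continuous_intros)
  note f2 = L2D(2)[OF assms(1)] and g2 = L2D(2)[OF assms(2)]
  have CS: "integrable M (\<lambda>x. cmod (f x) * cmod (g x))"
    "(\<integral>x. cmod (f x) * cmod (g x) \<partial>M)\<^sup>2 \<le> (\<integral>x. (cmod (f x))\<^sup>2 \<partial>M) * (\<integral>x. (cmod (g x))\<^sup>2 \<partial>M)"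
    using Cauchy_Schwarz_integral[of "\<lambda>x. cmod (f x)" M "\<lambda>x. cmod (g x)"] f2 g2 by simp_all
  have "integrable M (\<lambda>x. norm (cnj (f x) * g x))"
    using CS(1) by (simp add: norm_mult)
  then show int: "integrable M (\<lambda>x. cnj (f x) * g x)"
    by (rule integrable_norm_cancel) measurable
  have "cmod (\<integral>x. cnj (f x) * g x \<partial>M) \<le> (\<integral>x. cmod (cnj (f x) * g x) \<partial>M)"
    by (rule integral_norm_bound)
  also have "\<dots> = (\<integral>x. cmod (f x) * cmod (g x) \<partial>M)"
    by (simp add: norm_mult)
  finally have "(cmod (\<integral>x. cnj (f x) * g x \<partial>M))\<^sup>2 \<le> (\<integral>x. cmod (f x) * cmod (g x) \<partial>M)\<^sup>2"
    by (intro power_mono) auto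
  also have "\<dots> \<le> (\<integral>x. (cmod (f x))\<^sup>2 \<partial>M) * (\<integral>x. (cmod (g x))\<^sup>2 \<partial>M)"
    by (rule CS(2))
  finally show "(cmod (\<integral>x. cnj (f x) * g x \<partial>M))\<^sup>2 \<le> (\<integral>x. (cmod (f x))\<^sup>2 \<partial>M) * (\<integral>x. (cmod (g x))\<^sup>2 \<partial>M)" .
qed

lemma tendsto_L2_cnj_mult:
  assumes F: "\<And>N. F N \<in> L2 M" and f: "f \<in> L2 M" and g: "g \<in> L2 M"
    and lim: "(\<lambda>N. \<integral>x. (cmod (F N x - f x))\<^sup>2 \<partial>M) \<longlonglongrightarrow> 0"
  shows "(\<lambda>N. \<integral>x. cnj (F N x) * g x \<partial>M) \<longlonglongrightarrow> (\<integral>x. cnj (f x) * g x \<partial>M)"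
proof (rule LIM_zero_cancel, rule tendsto_norm_zero_cancel)
  have "(\<lambda>N. sqrt ((\<integral>x. (cmod (F N x - f x))\<^sup>2 \<partial>M) * (\<integral>x. (cmod (g x))\<^sup>2 \<partial>M))) \<longlonglongrightarrow> sqrt (0 * (\<integral>x. (cmod (g x))\<^sup>2 \<partial>M))"
    by (intro tendsto_intros lim)
  then have lim': "(\<lambda>N. sqrt ((\<integral>x. (cmod (F N x - f x))\<^sup>2 \<partial>M) * (\<integral>x. (cmod (g x))\<^sup>2 \<partial>M))) \<longlonglongrightarrow> 0" by simp
  show "(\<lambda>N. norm ((\<integral>x. cnj (F N x) * g x \<partial>M) - (\<integral>x. cnj (f x) * g x \<partial>M))) \<longlonglongrightarrow> 0"
  proof (rule tendsto_sandwich[OF _ _ tendsto_const lim'])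
    have "norm ((\<integral>x. cnj (F N x) * g x \<partial>M) - (\<integral>x. cnj (f x) * g x \<partial>M)) \<le> sqrt ((\<integral>x. (cmod (F N x - f x))\<^sup>2 \<partial>M) * (\<integral>x. (cmod (g x))\<^sup>2 \<partial>M))" for N
    proof (rule real_le_rsqrt)
      have "(\<integral>x. cnj (F N x) * g x \<partial>M) - (\<integral>x. cnj (f x) * g x \<partial>M) = (\<integral>x. cnj (F N x - f x) * g x \<partial>M)"
        using L2_cnj_mult(1)[OF F g] L2_cnj_mult(1)[OF f g] by (simp add: left_diff_distrib)
      then show "(norm ((\<integral>x. cnj (F N x) * g x \<partial>M) - (\<integral>x. cnj (f x) * g x \<partial>M)))\<^sup>2 \<le> (\<integral>x. (cmod (F N x - f x))\<^sup>2 \<partial>M) * (\<integral>x. (cmod (g x))\<^sup>2 \<partial>M)"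
        using L2_cnj_mult(2)[OF L2_diff[OF F f] g] by simp
    qed
    then show "\<forall>\<^sub>F N in sequentially. norm ((\<integral>x. cnj (F N x) * g x \<partial>M) - (\<integral>x. cnj (f x) * g x \<partial>M)) \<le> sqrt ((\<integral>x. (cmod (F N x - f x))\<^sup>2 \<partial>M) * (\<integral>x. (cmod (g x))\<^sup>2 \<partial>M))"
      by simp
  qed simp
qed

lemma L2_imp_integrable:
  fixes N :: "real measure"
  assumes "finite_measure N" "f \<in> L2 N"
  shows "integrable N f" "(\<integral>x. cmod (f x) \<partial>N)\<^sup>2 \<le> (\<integral>x. (cmod (f x))\<^sup>2 \<partial>N) * measure N (space N)"
proof -
  note [measurable] = L2D(1)[OF assms(2)] and f2 = L2D(2)[OF assms(2)]
  have one: "integrable N (\<lambda>x. 1\<^sup>2 :: real)"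
    by (rule finite_measure.integrable_const[OF assms(1)])
  have CS: "integrable N (\<lambda>x. cmod (f x) * 1)"
    "(\<integral>x. cmod (f x) * 1 \<partial>N)\<^sup>2 \<le> (\<integral>x. (cmod (f x))\<^sup>2 \<partial>N) * (\<integral>x. 1\<^sup>2 \<partial>N)"
    using Cauchy_Schwarz_integral[of "\<lambda>x. cmod (f x)" N "\<lambda>x. 1"] f2 one by simp_all
  show "integrable N f"
    by (rule integrable_norm_cancel) (use CS(1) in auto)
  show "(\<integral>x. cmod (f x) \<partial>N)\<^sup>2 \<le> (\<integral>x. (cmod (f x))\<^sup>2 \<partial>N) * measure N (space N)"
    using CS(2) by simp
qed

text \<open>On a finite measure an L2-Cauchy sequence is L1-Cauchy, hence has a subsequence
  converging almost everywhere. Fatou's lemma along it bounds the L2 distance of every late term to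
  the limit.\<close>

lemma Riesz_Fischer:
  fixes M :: "real measure"
  assumes fin: "finite_measure M" and F: "\<And>n. F n \<in> L2 M"
    and Cauchy: "\<And>e. 0 < e \<Longrightarrow> \<exists>N. \<forall>m\<ge>N. \<forall>n\<ge>N. (\<integral>x. (cmod (F m x - F n x))\<^sup>2 \<partial>M) \<le> e"
  shows "\<exists>f\<in>L2 M. (\<lambda>n. \<integral>x. (cmod (F n x - f x))\<^sup>2 \<partial>M) \<longlonglongrightarrow> 0"
proof -
  interpret finite_measure M by fact
  note [measurable] = L2D(1)[OF F]
  note diff2 = L2_diff[OF F F]
  have L1: "\<exists>N. \<forall>i\<ge>N. \<forall>j\<ge>N. (LINT x|M. cmod (F i x - F j x)) < e" if e: "e > 0" for e
  proof -
    \<comment> \<open>Adding 1 keeps the divisor positive even if the measure is zero.\<close>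
    define C where "C = measure M (space M) + 1"
    have C: "C > 0" "measure M (space M) \<le> C"
      unfolding C_def using measure_nonneg[of M "space M"] by linarith+
    have "0 < (e / 2)\<^sup>2 / C" using e C(1) by simp
    from Cauchy[OF this] obtain N where N: "(\<integral>x. (cmod (F m x - F n x))\<^sup>2 \<partial>M) \<le> (e / 2)\<^sup>2 / C" if "m \<ge> N" "n \<ge> N" for m n
      by blast
    have "(LINT x|M. cmod (F i x - F j x)) < e" if "i \<ge> N" "j \<ge> N" for i j
    proof -
      have "(LINT x|M. cmod (F i x - F j x))\<^sup>2 \<le> (\<integral>x. (cmod (F i x - F j x))\<^sup>2 \<partial>M) * measure M (space M)"
        by (rule L2_imp_integrable(2)[OF fin diff2])
      also have "\<dots> \<le> (e / 2)\<^sup>2 / C * C"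
        using N[OF that] C by (intro mult_mono) simp_all
      also have "\<dots> = (e / 2)\<^sup>2" using C by simp
      finally have "(LINT x|M. cmod (F i x - F j x)) \<le> e / 2"
        by (rule power2_le_imp_le) (use e in simp)
      then show ?thesis using e by simp
    qed
    then show ?thesis by blast
  qed
  obtain r where r: "strict_mono r" "AE x in M. Cauchy (\<lambda>i. F (r i) x)"
    by (rule cauchy_L1_AE_cauchy_subseq[OF L2_imp_integrable(1)[OF fin F] L1])
  define f where "f x = lim (\<lambda>i. F (r i) x)" for x
  have [measurable]: "f \<in> borel_measurable M"
    unfolding f_def[abs_def] by measurable
  have lim: "AE x in M. (\<lambda>i. F (r i) x) \<longlonglongrightarrow> f x"
    using r(2) by eventually_elim (simp add: f_def Cauchy_convergent_iff convergent_LIMSEQ_iff)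
  have main: "\<exists>N. \<forall>n\<ge>N. integrable M (\<lambda>x. (cmod (F n x - f x))\<^sup>2) \<and> (\<integral>x. (cmod (F n x - f x))\<^sup>2 \<partial>M) \<le> e" if e: "0 < e" for e
  proof -
    obtain N where N: "(\<integral>x. (cmod (F m x - F n x))\<^sup>2 \<partial>M) \<le> e" if "m \<ge> N" "n \<ge> N" for m n
      using Cauchy[OF e] by blast
    have "integrable M (\<lambda>x. (cmod (F n x - f x))\<^sup>2) \<and> (\<integral>x. (cmod (F n x - f x))\<^sup>2 \<partial>M) \<le> e" if n: "n \<ge> N" for n
    proof -
      have "(\<integral>\<^sup>+x. ennreal ((cmod (F n x - f x))\<^sup>2) \<partial>M) = (\<integral>\<^sup>+x. liminf (\<lambda>i. ennreal ((cmod (F n x - F (r i) x))\<^sup>2)) \<partial>M)"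
      proof (rule nn_integral_cong_AE)
        show "AE x in M. ennreal ((cmod (F n x - f x))\<^sup>2) = liminf (\<lambda>i. ennreal ((cmod (F n x - F (r i) x))\<^sup>2))"
          using lim
        proof eventually_elim
          case (elim x)
          have "(\<lambda>i. ennreal ((cmod (F n x - F (r i) x))\<^sup>2)) \<longlonglongrightarrow> ennreal ((cmod (F n x - f x))\<^sup>2)"
            by (intro tendsto_intros tendsto_ennrealI elim)
          then show ?case by (rule lim_imp_Liminf[OF sequentially_bot, symmetric])
        qed
      qed
      also have "\<dots> \<le> liminf (\<lambda>i. \<integral>\<^sup>+x. ennreal ((cmod (F n x - F (r i) x))\<^sup>2) \<partial>M)"
        by (rule nn_integral_liminf) measurable
      also have "\<dots> \<le> ennreal e"
      proof (rule Liminf_le)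
        show "\<forall>\<^sub>F i in sequentially. (\<integral>\<^sup>+x. ennreal ((cmod (F n x - F (r i) x))\<^sup>2) \<partial>M) \<le> ennreal e"
          using eventually_ge_at_top[of N]
        proof eventually_elim
          case (elim i)
          then have "r i \<ge> N" using seq_suble[OF r(1), of i] by simp
          have "(\<integral>\<^sup>+x. ennreal ((cmod (F n x - F (r i) x))\<^sup>2) \<partial>M) = ennreal (\<integral>x. (cmod (F n x - F (r i) x))\<^sup>2 \<partial>M)"
            by (rule nn_integral_eq_integral[OF L2D(2)[OF diff2]]) simp
          then show ?case
            using N[OF n \<open>r i \<ge> N\<close>] by (simp add: ennreal_leI)
        qed
      qed simp
      finally have le: "(\<integral>\<^sup>+x. ennreal ((cmod (F n x - f x))\<^sup>2) \<partial>M) \<le> ennreal e" .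
      have int: "integrable M (\<lambda>x. (cmod (F n x - f x))\<^sup>2)"
      proof (intro integrableI_nonneg)
        show "(\<integral>\<^sup>+x. ennreal ((cmod (F n x - f x))\<^sup>2) \<partial>M) < \<infinity>"
          using le ennreal_less_top[of e] by (simp only: le_less_trans infinity_ennreal_def)
        show "AE x in M. 0 \<le> (cmod (F n x - f x))\<^sup>2" by simp
      qed measurable
      moreover have "(\<integral>\<^sup>+x. ennreal ((cmod (F n x - f x))\<^sup>2) \<partial>M) = ennreal (\<integral>x. (cmod (F n x - f x))\<^sup>2 \<partial>M)"
        by (rule nn_integral_eq_integral[OF int]) simp
      ultimately show ?thesis
        using le e by simp
    qed
    then show ?thesis by blast
  qed
  obtain n where "integrable M (\<lambda>x. (cmod (F n x - f x))\<^sup>2)" using main[of 1] by (meson order_refl zero_less_one)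
  then have "(\<lambda>x. F n x - f x) \<in> L2 M" unfolding L2_def by simp
  then have "f \<in> L2 M" using L2_diff[OF F[of n], of "\<lambda>x. F n x - f x"] by simp
  moreover have "(\<lambda>n. \<integral>x. (cmod (F n x - f x))\<^sup>2 \<partial>M) \<longlonglongrightarrow> 0"
    unfolding tendsto_iff
  proof (intro allI impI)
    fix e :: real assume "0 < e"
    with main[of "e / 2"] obtain N where N: "\<forall>n\<ge>N. (\<integral>x. (cmod (F n x - f x))\<^sup>2 \<partial>M) \<le> e / 2" by (meson half_gt_zero)
    have le: "dist (\<integral>x. (cmod (F n x - f x))\<^sup>2 \<partial>M) 0 \<le> e / 2" if "n \<ge> N" for n
    proof -
      have "0 \<le> (\<integral>x. (cmod (F n x - f x))\<^sup>2 \<partial>M)" by simp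
      then show ?thesis using N that by (simp add: dist_real_def)
    qed
    have "e / 2 < e" using \<open>0 < e\<close> by simp
    then have "dist (\<integral>x. (cmod (F n x - f x))\<^sup>2 \<partial>M) 0 < e" if "n \<ge> N" for n
      by (rule le_less_trans[OF le[OF that]])
    then show "\<forall>\<^sub>F n in sequentially. dist (\<integral>x. (cmod (F n x - f x))\<^sup>2 \<partial>M) 0 < e"
      by (rule eventually_sequentiallyI)
  qed
  ultimately show ?thesis by blast
qed

section \<open>Measures with compact support\<close>

locale compact_measure = finite_borel_measure +
  fixes K :: real
  assumes AE_le_K: "AE x in M. \<bar>x\<bar> \<le> K"
begin

lemma measurable_M [measurable_cong]: "sets M = sets borel" by (rule M_is_borel)

lemma AE_bounded:
  fixes g :: "real \<Rightarrow> real"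
  assumes "continuous_on UNIV g"
  obtains B where "AE x in M. \<bar>g x\<bar> \<le> B"
proof -
  have "compact (g ` {- K..K})"
    by (intro compact_continuous_image continuous_on_subset[OF assms]) auto
  then have "bounded (g ` {- K..K})" by (rule compact_imp_bounded)
  then obtain B where B: "\<forall>x\<in>{- K..K}. \<bar>g x\<bar> \<le> B"
    unfolding bounded_iff by auto
  have "AE x in M. \<bar>g x\<bar> \<le> B"
    using AE_le_K by eventually_elim (rule bspec[OF B], auto)
  then show ?thesis by (rule that)
qed

lemma continuous_measurable: "continuous_on UNIV g \<Longrightarrow> g \<in> borel_measurable M" for g :: "real \<Rightarrow> real"
  using borel_measurable_continuous_onI[of g] by (simp add: measurable_cong_sets[OF M_is_borel refl])

lemma integrable_continuous_mult:
  fixes g f :: "real \<Rightarrow> real"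
  assumes g: "continuous_on UNIV g" and f: "integrable M f"
  shows "integrable M (\<lambda>x. g x * f x)"
proof -
  obtain B where B: "AE x in M. \<bar>g x\<bar> \<le> B" using AE_bounded[OF g] .
  have [measurable]: "g \<in> borel_measurable M" using continuous_measurable[OF g] .
  have [measurable]: "f \<in> borel_measurable M" using f by simp
  show ?thesis
  proof (rule Bochner_Integration.integrable_bound)
    show "integrable M (\<lambda>x. B * f x)" using f by simp
    show "AE x in M. norm (g x * f x) \<le> norm (B * f x)"
      using B by eventually_elim (simp add: abs_mult mult_right_mono)
  qed measurable
qed

lemma integrable_continuous: "continuous_on UNIV g \<Longrightarrow> integrable M g" for g :: "real \<Rightarrow> real"
  using integrable_continuous_mult[of g "\<lambda>x. 1"] by simp

text \<open>A continuous function is bounded on [-K, K], hence almost everywhere. With g(x) = x,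
  multiplication by x is defined on all of L2.\<close>

lemma L2_continuous_mult:
  fixes g :: "real \<Rightarrow> real"
  assumes g: "continuous_on UNIV g" and f: "f \<in> L2 M"
  shows "(\<lambda>x. complex_of_real (g x) * f x) \<in> L2 M"
proof -
  note [measurable] = L2D(1)[OF f] continuous_measurable[OF g]
  have "integrable M (\<lambda>x. (g x)\<^sup>2 * (cmod (f x))\<^sup>2)"
    by (intro integrable_continuous_mult continuous_intros g L2D(2)[OF f])
  then show ?thesis
    by (simp add: L2_def norm_mult power_mult_distrib)
qed

lemma L2_continuous:
  fixes g :: "real \<Rightarrow> real"
  assumes g: "continuous_on UNIV g"
  shows "(\<lambda>x. complex_of_real (g x)) \<in> L2 M"
  using L2_continuous_mult[OF g, of "\<lambda>x. 1"] by (simp add: L2_def)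

lemma integrable_continuous_mult_L2:
  fixes g :: "real \<Rightarrow> real"
  assumes "continuous_on UNIV g" "f \<in> L2 M"
  shows "integrable M (\<lambda>x. complex_of_real (g x) * f x)"
  using L2_imp_integrable(1)[OF _ L2_continuous_mult[OF assms]] finite_measure_axioms by blast

text \<open>A polynomial within e of g on [-K, K] integrates to 0 against f, so the integral is at
  most e times the L1 norm of f, for every e > 0.\<close>

lemma integral_continuous_mult_eq_0:
  fixes f g :: "real \<Rightarrow> real"
  assumes f: "integrable M f" and mom: "\<And>n. (\<integral>x. x ^ n * f x \<partial>M) = 0" and g: "continuous_on UNIV g"
  shows "(\<integral>x. g x * f x \<partial>M) = 0"
proof -
  define C where "C = (\<integral>x. \<bar>f x\<bar> \<partial>M)"
  have C: "0 \<le> C" by (simp add: C_def)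
  have bound: "\<bar>\<integral>x. g x * f x \<partial>M\<bar> \<le> e * C" if e: "0 < e" for e
  proof -
    obtain h where h: "real_polynomial_function h" "\<And>x. x \<in> {- K..K} \<Longrightarrow> \<bar>g x - h x\<bar> < e"
      using Stone_Weierstrass_real_polynomial_function[OF _ continuous_on_subset[OF g] e, of "{- K..K}"] by auto
    then obtain a n where ha: "h = (\<lambda>x. \<Sum>i\<le>n. a i * x ^ i)"
      by (auto simp: real_polynomial_function_iff_sum)
    have hc: "continuous_on UNIV h" unfolding ha by (intro continuous_intros)
    have pw: "integrable M (\<lambda>x. x ^ i * f x)" for i
      by (intro integrable_continuous_mult f continuous_intros)
    have "(\<integral>x. h x * f x \<partial>M) = (\<integral>x. (\<Sum>i\<le>n. a i * (x ^ i * f x)) \<partial>M)"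
      by (simp add: ha sum_distrib_right mult.assoc)
    also have "\<dots> = 0" using pw mom by simp
    finally have "(\<integral>x. g x * f x \<partial>M) = (\<integral>x. g x * f x \<partial>M) - (\<integral>x. h x * f x \<partial>M)" by simp
    also have "\<dots> = (\<integral>x. (g x - h x) * f x \<partial>M)"
      using integrable_continuous_mult[OF g f] integrable_continuous_mult[OF hc f] by (simp add: left_diff_distrib)
    finally have "\<bar>\<integral>x. g x * f x \<partial>M\<bar> \<le> (\<integral>x. \<bar>(g x - h x) * f x\<bar> \<partial>M)"
      by simp
    also have "\<dots> \<le> (\<integral>x. e * \<bar>f x\<bar> \<partial>M)"
    proof (rule integral_mono_AE)
      show "integrable M (\<lambda>x. \<bar>(g x - h x) * f x\<bar>)"
        by (intro integrable_abs integrable_continuous_mult continuous_on_diff g hc f)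
      show "AE x in M. \<bar>(g x - h x) * f x\<bar> \<le> e * \<bar>f x\<bar>"
        using AE_le_K
      proof eventually_elim
        case (elim x)
        then have "\<bar>g x - h x\<bar> \<le> e" using h(2)[of x] by (simp add: abs_le_iff less_imp_le)
        then show ?case by (simp add: abs_mult mult_right_mono)
      qed
    qed (use f in simp)
    finally show ?thesis by (simp add: C_def)
  qed
  define t where "t = \<bar>\<integral>x. g x * f x \<partial>M\<bar>"
  show ?thesis
  proof (rule ccontr)
    assume "(\<integral>x. g x * f x \<partial>M) \<noteq> 0"
    then have t: "0 < t" by (simp add: t_def)
    \<comment> \<open>This e makes the bound less than t/2; the 1 guards against C = 0.\<close>
    have "t \<le> t / (2 * (C + 1)) * C"
      unfolding t_def by (rule bound) (use t C in \<open>simp add: t_def\<close>)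
    also have "\<dots> \<le> t / 2"
      using C t by (simp add: field_simps)
    finally show False using t by simp
  qed
qed

text \<open>Vanishing integrals pass from polynomials to continuous functions, from these to
  half-lines and then to all Borel sets, which forces f = 0 almost everywhere.\<close>

lemma AE_eq_0_of_moments_real:
  fixes f :: "real \<Rightarrow> real"
  assumes f: "integrable M f" and mom: "\<And>n. (\<integral>x. x ^ n * f x \<partial>M) = 0"
  shows "AE x in M. f x = 0"
proof -
  have [measurable]: "f \<in> borel_measurable M" using f by simp
  have all: "(\<integral>x. f x \<partial>M) = 0" using mom[of 0] by simp
  have int: "set_integrable M A f" if "A \<in> sets borel" for A
    unfolding set_integrable_def using f that measurable_M by (intro integrable_mult_indicator) auto
  have Iic: "(\<integral>x\<in>{..b}. f x \<partial>M) = 0" for b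
  proof -
    \<comment> \<open>Ramps equal to 1 up to b and falling linearly to 0 on [b, b + 1/k]; they tend
      to the indicator of the half-line.\<close>
    define g where "g k x = max 0 (min 1 (1 - real k * (x - b)))" for k x
    have gc: "continuous_on UNIV (g k)" for k unfolding g_def by (intro continuous_intros)
    have "(\<lambda>k. \<integral>x. g k x * f x \<partial>M) \<longlonglongrightarrow> (\<integral>x. indicator {..b} x * f x \<partial>M)"
    proof (rule Bochner_Integration.integral_dominated_convergence[where w="\<lambda>x. \<bar>f x\<bar>"])
      show "AE x in M. (\<lambda>k. g k x * f x) \<longlonglongrightarrow> indicator {..b} x * f x"
      proof (rule AE_I2)
        fix x
        have "(\<lambda>k. g k x) \<longlonglongrightarrow> indicator {..b} x"
        proof (cases "x \<le> b")
          case True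
          then have "g k x = 1" for k by (simp add: g_def mult_nonneg_nonpos)
          then show ?thesis using True by simp
        next
          case False
          then obtain k0 where k0: "1 < real k0 * (x - b)"
            using reals_Archimedean3[of "x - b"] by auto
          have "\<forall>\<^sub>F k in sequentially. g k x = 0"
            using eventually_ge_at_top[of k0]
          proof eventually_elim
            case (elim k)
            then have "real k0 * (x - b) \<le> real k * (x - b)" using False by (intro mult_right_mono) auto
            then show ?case using k0 by (simp add: g_def)
          qed
          then show ?thesis using False by (simp add: tendsto_eventually)
        qed
        then show "(\<lambda>k. g k x * f x) \<longlonglongrightarrow> indicator {..b} x * f x"
          by (intro tendsto_intros)
      qed
      show "AE x in M. norm (g k x * f x) \<le> \<bar>f x\<bar>" for k
        by (rule AE_I2) (auto simp: g_def abs_mult mult_left_le_one_le)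
      show "(\<lambda>x. g k x * f x) \<in> borel_measurable M" for k
        using continuous_measurable[OF gc] by measurable
    qed (use f in auto)
    then show ?thesis
      using integral_continuous_mult_eq_0[OF f mom gc] by (simp add: set_lebesgue_integral_def LIMSEQ_const_iff)
  qed
  have "(\<integral>x\<in>A. f x \<partial>M) = 0" if "A \<in> sets borel" for A
  proof -
    have "Int_stable (range (\<lambda>a. {..a::real}))" "range (\<lambda>a. {..a::real}) \<subseteq> Pow UNIV"
      by (auto simp: Int_stable_def)
    moreover have "A \<in> sigma_sets UNIV (range (\<lambda>a. {..a::real}))"
      using that by (simp add: borel_eq_atMost)
    \<comment> \<open>The sets over which f integrates to 0 form a Dynkin system, and the half-lines
      are closed under intersection.\<close>
    ultimately show ?thesis
    proof (induction rule: sigma_sets_induct_disjoint)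
      case (basic A)
      then show ?case using Iic by auto
    next
      case empty
      then show ?case by (simp add: set_lebesgue_integral_def)
    next
      case (compl A)
      then have A: "A \<in> sets borel" by (simp add: borel_eq_atMost)
      have "(\<integral>x\<in>(UNIV - A). f x \<partial>M) = (\<integral>x. f x - indicator A x * f x \<partial>M)"
        unfolding set_lebesgue_integral_def by (intro Bochner_Integration.integral_cong) (auto simp: indicator_def)
      also have "\<dots> = 0"
        using f int[OF A] compl all by (simp add: set_lebesgue_integral_def set_integrable_def)
      finally show ?case .
    next
      case (union A)
      then have A: "A i \<in> sets M" for i
        using measurable_M by (auto simp: borel_eq_atMost)
      have "(\<integral>x\<in>(\<Union>i. A i). f x \<partial>M) = (\<Sum>i. \<integral>x\<in>A i. f x \<partial>M)"
        using union A measurable_M by (intro lebesgue_integral_countable_add int) (auto simp: disjoint_family_on_def)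
      then show ?case using union by simp
    qed
  qed
  then show ?thesis
    using f measurable_M by (intro density_unique_real) (auto simp: set_lebesgue_integral_def)
qed

lemma AE_eq_0_of_moments:
  assumes f: "f \<in> L2 M" and mom: "\<And>n. (\<integral>x. complex_of_real (x ^ n) * f x \<partial>M) = 0"
  shows "AE x in M. f x = 0"
proof -
  have intf: "integrable M f"
    using L2_imp_integrable(1)[OF _ f] finite_measure_axioms by blast
  have int: "integrable M (\<lambda>x. complex_of_real (x ^ n) * f x)" for n
    by (intro integrable_continuous_mult_L2 f continuous_intros)
  have "AE x in M. Re (f x) = 0"
  proof (rule AE_eq_0_of_moments_real)
    show "(\<integral>x. x ^ n * Re (f x) \<partial>M) = 0" for n
      using arg_cong[OF mom[of n], of Re] integral_Re[OF int[of n]] by (simp flip: of_real_power)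
  qed (use intf in auto)
  moreover have "AE x in M. Im (f x) = 0"
  proof (rule AE_eq_0_of_moments_real)
    show "(\<integral>x. x ^ n * Im (f x) \<partial>M) = 0" for n
      using arg_cong[OF mom[of n], of Im] integral_Im[OF int[of n]] by (simp flip: of_real_power)
  qed (use intf in auto)
  ultimately show ?thesis by eventually_elim (simp add: complex_eq_iff)
qed

end

section \<open>Orthonormal polynomials\<close>

lemma cnj_mult_eq_norm_square: "cnj z * z = complex_of_real ((cmod z)\<^sup>2)"
  by (simp only: complex_norm_square mult.commute)

text \<open>Degree and orthonormality determine each polynomial only up to sign;
  \<open>lead_p\<close> selects the one that Gram-Schmidt produces.\<close>

locale orthonormal_polynomials = compact_measure +
  fixes p :: "nat \<Rightarrow> real poly"
  assumes degree_p: "degree (p n) = n"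
    and lead_p: "0 < lead_coeff (p n)"
    and orth_p: "(\<integral>x. poly (p m) x * poly (p n) x \<partial>M) = (if m = n then 1 else 0)"
begin

text \<open>Subtracting the right multiple of p_N removes the coefficient of x^N. Bounding
  coefficients instead of the degree covers the zero polynomial at N = 0.\<close>

lemma poly_expansion:
  "\<forall>i\<ge>N. coeff r i = 0 \<Longrightarrow> \<exists>c. r = (\<Sum>k<N. smult (c k) (p k))"
proof (induction N arbitrary: r)
  case 0
  then show ?case by (auto simp: poly_eq_iff)
next
  case (Suc N)
  define d where "d = coeff r N / lead_coeff (p N)"
  have "\<forall>i\<ge>N. coeff (r - smult d (p N)) i = 0"
  proof (intro allI impI)
    fix i assume "N \<le> i"
    show "coeff (r - smult d (p N)) i = 0"
    proof (cases "i = N")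
      case True
      then show ?thesis using lead_p[of N] by (simp add: d_def degree_p)
    next
      case False
      then show ?thesis using \<open>N \<le> i\<close> Suc.prems by (simp add: coeff_eq_0 degree_p)
    qed
  qed
  from Suc.IH[OF this] obtain c where "r - smult d (p N) = (\<Sum>k<N. smult (c k) (p k))" by blast
  then have "r = (\<Sum>k<Suc N. smult ((c(N := d)) k) (p k))"
    by (simp add: algebra_simps)
  then show ?case by blast
qed

lemma continuous_poly: "continuous_on UNIV (poly q)" for q :: "real poly"
  by (intro continuous_intros)

lemma integrable_poly_mult: "integrable M (\<lambda>x. poly q x * poly r x)"
  by (intro integrable_continuous continuous_intros)

lemma integral_p_expansion:
  assumes "finite F"
  shows "(\<integral>x. poly (p m) x * poly (\<Sum>k\<in>F. smult (c k) (p k)) x \<partial>M) = (if m \<in> F then c m else 0)"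
proof -
  have "(\<integral>x. poly (p m) x * poly (\<Sum>k\<in>F. smult (c k) (p k)) x \<partial>M) = (\<integral>x. (\<Sum>k\<in>F. c k * (poly (p m) x * poly (p k) x)) \<partial>M)"
    by (simp add: poly_sum sum_distrib_left mult_ac)
  also have "\<dots> = (\<Sum>k\<in>F. c k * (\<integral>x. poly (p m) x * poly (p k) x \<partial>M))"
    using integrable_poly_mult by simp
  also have "\<dots> = (if m \<in> F then c m else 0)"
    by (simp add: orth_p assms if_distrib cong: if_cong)
  finally show ?thesis .
qed

text \<open>With l the leading coefficient of p_n, x^n is p_n / l plus a combination of earlier p_k.
  Removing the projections leaves p_n / l, of norm 1/l since l > 0.\<close>

lemma orthonormalized_monomials_p: "orthonormalized_monomials M p"
proof -
  have "integrable M (\<lambda>x. x ^ n)" for n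
    by (intro integrable_continuous continuous_intros)
  moreover have "(\<integral>x. (poly g x)\<^sup>2 \<partial>M) > 0 \<and> p n = smult (1 / sqrt (\<integral>x. (poly g x)\<^sup>2 \<partial>M)) g"
    if g: "g = monom 1 n - (\<Sum>k<n. smult (\<integral>x. poly (p k) x * x ^ n \<partial>M) (p k))" for n g
  proof -
    define l where "l = lead_coeff (p n)"
    have l: "0 < l" unfolding l_def by (rule lead_p)
    have "\<forall>i\<ge>n. coeff (monom 1 n - smult (1 / l) (p n)) i = 0"
    proof (intro allI impI)
      fix i assume "n \<le> i"
      then show "coeff (monom 1 n - smult (1 / l) (p n)) i = 0"
        using l by (cases "i = n") (auto simp: coeff_eq_0 degree_p l_def)
    qed
    from poly_expansion[OF this] obtain c where c: "monom 1 n - smult (1 / l) (p n) = (\<Sum>k<n. smult (c k) (p k))"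
      by blast
    define d where "d = c(n := 1 / l)"
    have mon: "monom 1 n = (\<Sum>k<Suc n. smult (d k) (p k))"
      using c by (simp add: d_def algebra_simps)
    have "(\<integral>x. poly (p k) x * x ^ n \<partial>M) = c k" if "k < n" for k
    proof -
      have "(\<integral>x. poly (p k) x * x ^ n \<partial>M) = (\<integral>x. poly (p k) x * poly (\<Sum>k<Suc n. smult (d k) (p k)) x \<partial>M)"
        unfolding mon[symmetric] by (simp add: poly_monom)
      also have "\<dots> = c k"
        by (subst integral_p_expansion) (use that in \<open>auto simp: d_def\<close>)
      finally show ?thesis .
    qed
    then have "g = monom 1 n - (\<Sum>k<n. smult (c k) (p k))"
      unfolding g by simp
    then have gl: "g = smult (1 / l) (p n)"
      by (simp add: c[symmetric])
    have "(\<integral>x. (poly g x)\<^sup>2 \<partial>M) = (\<integral>x. (1 / l)\<^sup>2 * (poly (p n) x * poly (p n) x) \<partial>M)"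
      by (simp add: gl power2_eq_square mult_ac)
    also have "\<dots> = (1 / l)\<^sup>2" by (simp add: orth_p)
    finally have "(\<integral>x. (poly g x)\<^sup>2 \<partial>M) = (1 / l)\<^sup>2" .
    then show ?thesis using l by (simp add: gl)
  qed
  ultimately show ?thesis
    unfolding orthonormalized_monomials_def Let_def by blast
qed

abbreviation e :: "nat \<Rightarrow> real \<Rightarrow> complex" where
  "e n x \<equiv> complex_of_real (poly (p n) x)"

lemma L2_e: "e n \<in> L2 M"
  by (rule L2_continuous[OF continuous_poly])

lemma integrable_e_mult: "f \<in> L2 M \<Longrightarrow> integrable M (\<lambda>x. e n x * f x)"
  by (rule integrable_continuous_mult_L2[OF continuous_poly])

lemma L2_e_sum: "(\<lambda>x. \<Sum>n\<in>F. d n * e n x) \<in> L2 M"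
  by (intro L2_sum L2_mult_const L2_e)

lemma integral_e_e: "(\<integral>x. e m x * e n x \<partial>M) = (if m = n then 1 else 0)"
  using orth_p[of m n] by (simp flip: of_real_mult)

lemma integral_e_sum:
  assumes "finite F"
  shows "(\<integral>x. e m x * (\<Sum>n\<in>F. d n * e n x) \<partial>M) = (if m \<in> F then d m else 0)"
proof -
  have "(\<integral>x. e m x * (\<Sum>n\<in>F. d n * e n x) \<partial>M) = (\<integral>x. (\<Sum>n\<in>F. d n * (e m x * e n x)) \<partial>M)"
    by (simp add: sum_distrib_left mult_ac)
  also have "\<dots> = (\<Sum>n\<in>F. d n * (\<integral>x. e m x * e n x \<partial>M))"
    using integrable_e_mult[OF L2_e] by simp
  also have "\<dots> = (if m \<in> F then d m else 0)"
    unfolding integral_e_e using assms by (simp add: if_distrib cong: if_cong)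
  finally show ?thesis .
qed

lemma integral_cnj_e_sum:
  assumes "finite F" "f \<in> L2 M"
  shows "(\<integral>x. cnj (\<Sum>n\<in>F. d n * e n x) * f x \<partial>M) = (\<Sum>n\<in>F. cnj (d n) * (\<integral>x. e n x * f x \<partial>M))"
proof -
  have "(\<integral>x. cnj (\<Sum>n\<in>F. d n * e n x) * f x \<partial>M) = (\<integral>x. (\<Sum>n\<in>F. cnj (d n) * (e n x * f x)) \<partial>M)"
    by (simp add: sum_distrib_right mult.assoc)
  also have "\<dots> = (\<Sum>n\<in>F. cnj (d n) * (\<integral>x. e n x * f x \<partial>M))"
    using integrable_e_mult[OF assms(2)] by simp
  finally show ?thesis .
qed

lemma integral_norm_e_sum:
  assumes "finite F"
  shows "(\<integral>x. (cmod (\<Sum>n\<in>F. d n * e n x))\<^sup>2 \<partial>M) = (\<Sum>n\<in>F. (cmod (d n))\<^sup>2)"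
proof -
  have "complex_of_real (\<integral>x. (cmod (\<Sum>n\<in>F. d n * e n x))\<^sup>2 \<partial>M)
      = (\<integral>x. cnj (\<Sum>n\<in>F. d n * e n x) * (\<Sum>n\<in>F. d n * e n x) \<partial>M)"
    unfolding cnj_mult_eq_norm_square by (rule integral_complex_of_real[symmetric])
  also have "\<dots> = (\<Sum>n\<in>F. cnj (d n) * d n)"
    by (subst integral_cnj_e_sum[OF assms L2_e_sum]) (simp add: integral_e_sum assms)
  also have "\<dots> = complex_of_real (\<Sum>n\<in>F. (cmod (d n))\<^sup>2)"
    unfolding cnj_mult_eq_norm_square by simp
  finally show ?thesis unfolding of_real_eq_iff .
qed

text \<open>Monomials are combinations of the p_k, so equal coefficients mean that the difference
  has vanishing moments. Every almost-everywhere identity for the unitary map is proved this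
  way.\<close>

lemma AE_eq_of_coeffs:
  assumes f: "f \<in> L2 M" and g: "g \<in> L2 M"
    and eq: "\<And>n. (\<integral>x. e n x * f x \<partial>M) = (\<integral>x. e n x * g x \<partial>M)"
  shows "AE x in M. f x = g x"
proof -
  have h: "(\<lambda>x. f x - g x) \<in> L2 M" by (rule L2_diff[OF f g])
  have e0: "(\<integral>x. e n x * (f x - g x) \<partial>M) = 0" for n
    using eq[of n] integrable_e_mult[OF f] integrable_e_mult[OF g] by (simp add: right_diff_distrib)
  have "(\<integral>x. complex_of_real (x ^ n) * (f x - g x) \<partial>M) = 0" for n
  proof -
    obtain c where c: "monom 1 n = (\<Sum>k<Suc n. smult (c k) (p k))"
      using poly_expansion[of "Suc n" "monom 1 n"] by auto
    have xn: "complex_of_real (x ^ n) = (\<Sum>k<Suc n. complex_of_real (c k) * e k x)" for x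
      using arg_cong[OF c, of "\<lambda>q. poly q x"] by (simp add: poly_monom poly_sum flip: of_real_mult of_real_sum of_real_add)
    have "(\<integral>x. complex_of_real (x ^ n) * (f x - g x) \<partial>M) = (\<integral>x. (\<Sum>k<Suc n. complex_of_real (c k) * (e k x * (f x - g x))) \<partial>M)"
      unfolding xn sum_distrib_right mult.assoc ..
    also have "\<dots> = (\<Sum>k<Suc n. complex_of_real (c k) * (\<integral>x. e k x * (f x - g x) \<partial>M))"
      using integrable_e_mult[OF h] by (subst Bochner_Integration.integral_sum) auto
    finally show ?thesis unfolding e0 by simp
  qed
  from AE_eq_0_of_moments[OF h this] show ?thesis by simp
qed

lemma exists_unitary:
  fixes \<phi> :: "nat \<Rightarrow> 'h::complex_hilbert_space"
  assumes basis: "orthonormal_basis \<phi>"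
  obtains U where "unitary_onto_L2 M U" "\<And>u n. (\<integral>x. e n x * U u x \<partial>M) = cinner (\<phi> n) u"
proof -
  note on = orthonormal_basis_imp_orthonormal[OF basis]
  define S where "S u N x = (\<Sum>n<N. cinner (\<phi> n) u * e n x)" for u :: 'h and N x
  have SL2: "S u N \<in> L2 M" for u N
    unfolding S_def[abs_def] by (rule L2_e_sum)
  have "\<exists>f\<in>L2 M. (\<lambda>N. \<integral>x. (cmod (S u N x - f x))\<^sup>2 \<partial>M) \<longlonglongrightarrow> 0" for u
  proof (rule Riesz_Fischer[OF finite_measure_axioms SL2])
    fix \<epsilon> :: real assume "0 < \<epsilon>"
    then obtain N where N: "\<And>m n. m \<ge> N \<Longrightarrow> norm (\<Sum>k=m..<n. (cmod (cinner (\<phi> k) u))\<^sup>2) < \<epsilon>"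
      using summable_fourier_coeffs[OF on, of u] unfolding summable_Cauchy by blast
    have le: "(\<integral>x. (cmod (S u n x - S u m x))\<^sup>2 \<partial>M) \<le> \<epsilon>" if "N \<le> m" "m \<le> n" for m n
    proof -
      have "S u n x - S u m x = (\<Sum>k=m..<n. cinner (\<phi> k) u * e k x)" for x
        using sum_diff_nat_ivl[of 0 m n "\<lambda>k. cinner (\<phi> k) u * e k x"] that by (simp add: S_def lessThan_atLeast0)
      then have "(\<integral>x. (cmod (S u n x - S u m x))\<^sup>2 \<partial>M) = (\<Sum>k=m..<n. (cmod (cinner (\<phi> k) u))\<^sup>2)"
        by (simp add: integral_norm_e_sum)
      also have "\<dots> \<le> norm \<dots>" by simp
      also have "\<dots> < \<epsilon>" using N[OF that(1)] .
      finally show ?thesis by simp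
    qed
    have "(\<integral>x. (cmod (S u m x - S u n x))\<^sup>2 \<partial>M) \<le> \<epsilon>" if "N \<le> m" "N \<le> n" for m n
      using le[of n m] le[of m n] that by (cases "m \<le> n") (simp_all add: norm_minus_commute)
    then show "\<exists>N. \<forall>m\<ge>N. \<forall>n\<ge>N. (\<integral>x. (cmod (S u m x - S u n x))\<^sup>2 \<partial>M) \<le> \<epsilon>" by blast
  qed
  then have ex: "\<exists>f. f \<in> L2 M \<and> (\<lambda>N. \<integral>x. (cmod (S u N x - f x))\<^sup>2 \<partial>M) \<longlonglongrightarrow> 0" for u
    by (simp only: Bex_def)
  \<comment> \<open>A choice of representative of the L2 limit; this is why linearity holds only
    almost everywhere.\<close>
  define U where "U u = (SOME f. f \<in> L2 M \<and> (\<lambda>N. \<integral>x. (cmod (S u N x - f x))\<^sup>2 \<partial>M) \<longlonglongrightarrow> 0)" for u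
  have UL2: "U u \<in> L2 M" and Ulim: "(\<lambda>N. \<integral>x. (cmod (S u N x - U u x))\<^sup>2 \<partial>M) \<longlonglongrightarrow> 0" for u
    using someI_ex[OF ex[of u]] unfolding U_def by simp_all
  \<comment> \<open>Integrals against \<open>U u\<close> are limits of sums over the coefficients of
    u; this gives both the coefficients of \<open>U u\<close> and Parseval's identity.\<close>
  have lim: "(\<lambda>N. \<Sum>n<N. cnj (cinner (\<phi> n) u) * (\<integral>x. e n x * g x \<partial>M)) \<longlonglongrightarrow> (\<integral>x. cnj (U u x) * g x \<partial>M)"
    if g: "g \<in> L2 M" for u g
    using tendsto_L2_cnj_mult[OF SL2 UL2 g Ulim]
    unfolding S_def by (simp only: integral_cnj_e_sum[OF finite_lessThan g])
  have coeff: "(\<integral>x. e m x * U u x \<partial>M) = cinner (\<phi> m) u" for m u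
  proof -
    have "\<forall>\<^sub>F N in sequentially. (\<Sum>n<N. cnj (cinner (\<phi> n) u) * (\<integral>x. e n x * e m x \<partial>M)) = cnj (cinner (\<phi> m) u)"
      using eventually_gt_at_top[of m]
      by eventually_elim (simp add: integral_e_e if_distrib cong: if_cong)
    then have "(\<lambda>N. \<Sum>n<N. cnj (cinner (\<phi> n) u) * (\<integral>x. e n x * e m x \<partial>M)) \<longlonglongrightarrow> cnj (cinner (\<phi> m) u)"
      by (rule tendsto_eventually)
    from LIMSEQ_unique[OF this lim[OF L2_e]]
    have "cnj (cinner (\<phi> m) u) = (\<integral>x. cnj (U u x) * e m x \<partial>M)" .
    then have "cinner (\<phi> m) u = cnj (\<integral>x. cnj (U u x) * e m x \<partial>M)"
      by (simp flip: complex_cnj_cancel_iff[of "cinner (\<phi> m) u"] del: complex_cnj_cancel_iff)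
    also have "\<dots> = (\<integral>x. cnj (cnj (U u x) * e m x) \<partial>M)"
      by (rule Bochner_Integration.integral_cnj[symmetric])
    also have "\<dots> = (\<integral>x. e m x * U u x \<partial>M)"
      by (rule arg_cong[where f = "integral\<^sup>L M"]) (simp add: fun_eq_iff mult.commute)
    finally show ?thesis by simp
  qed
  have "unitary_onto_L2 M U"
    unfolding unitary_onto_L2_def
  proof (intro conjI allI ballI)
    show "U u \<in> L2 M" for u by (rule UL2)
    show "AE x in M. U (u + v) x = U u x + U v x" for u v
      by (rule AE_eq_of_coeffs[OF UL2 L2_add[OF UL2 UL2]])
         (simp add: distrib_left coeff cinner_add_right integrable_e_mult UL2)
    show "AE x in M. U (c *\<^sub>C u) x = c * U u x" for c u
    proof (rule AE_eq_of_coeffs[OF UL2 L2_mult_const[OF UL2]])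
      fix n
      have "(\<integral>x. e n x * (c * U u x) \<partial>M) = (\<integral>x. c * (e n x * U u x) \<partial>M)"
        by (simp add: mult.left_commute)
      then show "(\<integral>x. e n x * U (c *\<^sub>C u) x \<partial>M) = (\<integral>x. e n x * (c * U u x) \<partial>M)"
        by (simp add: coeff cinner_scaleC_right)
    qed
    show "(\<integral>x. cnj (U u x) * U v x \<partial>M) = cinner u v" for u v
    proof (rule LIMSEQ_unique[OF lim[OF UL2]])
      have "(\<lambda>N. cinner (\<Sum>n<N. cinner (\<phi> n) u *\<^sub>C \<phi> n) v) \<longlonglongrightarrow> cinner u v"
        using orthonormal_basis_expansion[OF basis, of u] unfolding sums_def
        by (intro cinner.tendsto tendsto_const)
      then show "(\<lambda>N. \<Sum>n<N. cnj (cinner (\<phi> n) u) * (\<integral>x. e n x * U v x \<partial>M)) \<longlonglongrightarrow> cinner u v"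
        by (simp add: cinner.sum_left cinner_scaleC_left coeff)
    qed
    show "\<exists>u. AE x in M. U u x = f x" if f: "f \<in> L2 M" for f
    proof -
      define c where "c n = (\<integral>x. e n x * f x \<partial>M)" for n
      have "(\<Sum>n<N. (cmod (c n))\<^sup>2) \<le> (\<integral>x. (cmod (f x))\<^sup>2 \<partial>M)" for N
      proof -
        \<comment> \<open>Bessel's inequality for f: Cauchy-Schwarz against the partial sum
          \<open>P\<close> of f itself gives s^2 \<le> s |f|^2.\<close>
        define s where "s = (\<Sum>n<N. (cmod (c n))\<^sup>2)"
        define P where "P x = (\<Sum>n<N. c n * e n x)" for x
        have P: "P \<in> L2 M" unfolding P_def[abs_def] by (rule L2_e_sum)
        have "(\<integral>x. cnj (P x) * f x \<partial>M) = complex_of_real s"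
          unfolding P_def integral_cnj_e_sum[OF finite_lessThan f] c_def[symmetric] s_def cnj_mult_eq_norm_square by simp
        moreover have "(\<integral>x. (cmod (P x))\<^sup>2 \<partial>M) = s"
          unfolding P_def s_def by (simp add: integral_norm_e_sum)
        ultimately have "s\<^sup>2 \<le> s * (\<integral>x. (cmod (f x))\<^sup>2 \<partial>M)"
          using L2_cnj_mult(2)[OF P f] by simp
        moreover have "0 \<le> s" by (simp add: s_def sum_nonneg)
        ultimately have "s \<le> (\<integral>x. (cmod (f x))\<^sup>2 \<partial>M)"
          by (cases "s = 0") (simp_all add: power2_eq_square)
        then show ?thesis by (simp add: s_def)
      qed
      then have "summable (\<lambda>n. (cmod (c n))\<^sup>2)"
        by (intro summableI_nonneg_bounded) auto
      from summable_sums[OF summable_orthonormal[OF on this]]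
      obtain u where u: "(\<lambda>n. c n *\<^sub>C \<phi> n) sums u" by blast
      have "AE x in M. U u x = f x"
        by (rule AE_eq_of_coeffs[OF UL2 f]) (simp add: coeff cinner_orthonormal_suminf[OF on u] c_def)
      then show ?thesis by blast
    qed
  qed
  then show ?thesis using coeff that by blast
qed

end

section \<open>The realization\<close>

text \<open>The three-term recurrence solved for its highest term; the separate clause for degree 1
  keeps \<open>b 0\<close> out.\<close>

fun jacobi_poly :: "(nat \<Rightarrow> real) \<Rightarrow> nat \<Rightarrow> real poly" where
  "jacobi_poly b 0 = 1"
| "jacobi_poly b (Suc 0) = smult (1 / b 1) [:0, 1:]"
| "jacobi_poly b (Suc (Suc n)) =
     smult (1 / b (Suc (Suc n))) (pCons 0 (jacobi_poly b (Suc n)) - smult (b (Suc n)) (jacobi_poly b n))"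

lemma jacobi_poly_recurrence:
  assumes "\<And>n. b (Suc n) \<noteq> 0"
  shows "x * poly (jacobi_poly b n) x =
    (if n = 0 then 0 else b n * poly (jacobi_poly b (n - 1)) x) + b (Suc n) * poly (jacobi_poly b (Suc n)) x"
  using assms by (cases n) auto

lemma jacobi_poly_degree:
  assumes b: "\<And>n. 0 < b (Suc n)"
  shows "degree (jacobi_poly b n) = n \<and> 0 < lead_coeff (jacobi_poly b n)"
proof (induction n rule: less_induct)
  case (less n)
  consider "n = 0" | "n = 1" | m where "n = Suc (Suc m)"
    by (metis One_nat_def not0_implies_Suc)
  then show ?case
  proof cases
    case 3
    let ?r = "pCons 0 (jacobi_poly b (Suc m)) - smult (b (Suc m)) (jacobi_poly b m)"
    have IH: "degree (jacobi_poly b m) = m" "degree (jacobi_poly b (Suc m)) = Suc m"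
      "0 < lead_coeff (jacobi_poly b (Suc m))"
      using less[of m] less[of "Suc m"] 3 by auto
    then have nz: "jacobi_poly b (Suc m) \<noteq> 0" by auto
    have c: "coeff (jacobi_poly b m) (Suc (Suc m)) = 0"
      using IH(1) by (simp add: coeff_eq_0)
    have "degree ?r \<le> Suc (Suc m)"
      using IH nz by (intro degree_diff_le order_trans[OF degree_smult_le]) auto
    moreover have "coeff ?r (Suc (Suc m)) = lead_coeff (jacobi_poly b (Suc m))"
      using c IH(2) by simp
    moreover from this have "Suc (Suc m) \<le> degree ?r"
      using IH(3) by (intro le_degree) linarith
    ultimately have "degree ?r = Suc (Suc m)" "lead_coeff ?r = lead_coeff (jacobi_poly b (Suc m))"
      by simp_all
    then show ?thesis
      using IH(3) b[of "Suc m"] unfolding 3 jacobi_poly.simps lead_coeff_smult by simp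
  qed (use b[of 0] in auto)
qed

section \<open>Recurrence coefficients and normalization\<close>

lemma xseq_Suc: "xseq q \<alpha> (Suc n) = (1 + \<alpha> * q ^ n) * ((1 - q ^ Suc n) / (1 - q))"
  by (simp add: xseq_def qnum_def)

context
  fixes q \<alpha> :: real
  assumes q: "0 < q" "q < 1" and \<alpha>: "-1 < \<alpha>"
begin

lemma xseq_Suc_pos: "0 < xseq q \<alpha> (Suc n)"
proof -
  have "q ^ Suc n < 1" using q by (intro power_Suc_less_one)
  then show ?thesis
    unfolding xseq_Suc using q one_plus_mult_power_pos[OF q \<alpha>, of n] by simp
qed

lemma xseq_le: "xseq q \<alpha> n \<le> (1 + \<bar>\<alpha>\<bar>) / (1 - q)"
proof (cases n)
  case 0
  then show ?thesis using q by (simp add: xseq_def qnum_def)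
next
  case (Suc m)
  have le1: "0 < q ^ k" "q ^ k \<le> 1" for k using q by (auto simp: power_le_one)
  have "\<alpha> * q ^ m \<le> \<bar>\<alpha>\<bar> * 1"
    using le1[of m] by (intro mult_mono) auto
  moreover have "(1 - q ^ Suc m) / (1 - q) \<le> 1 / (1 - q)"
    using q le1[of "Suc m"] by (intro divide_right_mono) auto
  moreover have "0 \<le> (1 - q ^ Suc m) / (1 - q)"
    using q le1[of "Suc m"] by simp
  ultimately have "(1 + \<alpha> * q ^ m) * ((1 - q ^ Suc m) / (1 - q)) \<le> (1 + \<bar>\<alpha>\<bar>) * (1 / (1 - q))"
    using one_plus_mult_power_pos[OF q \<alpha>, of m] by (intro mult_mono) auto
  then show ?thesis by (simp add: Suc xseq_Suc)
qed

lemma xseq_nonneg: "0 \<le> xseq q \<alpha> n"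
  using xseq_Suc_pos by (cases n) (auto simp: xseq_def qnum_def less_imp_le)

text \<open>The ratio of consecutive normalizing constants is the squared recurrence coefficient up
  to 1 - q, and the scaling of x absorbs 1 - q.\<close>

lemma qpochs_Suc: "qpochs [- \<alpha>, q] q (Suc n) = qpochs [- \<alpha>, q] q n * ((1 - q) * xseq q \<alpha> (Suc n))"
  using q by (simp add: qpochs_def qpoch_Suc xseq_Suc)

lemma qpochs_pos: "0 < qpochs [- \<alpha>, q] q n"
proof (induction n)
  case 0
  then show ?case by (simp add: qpochs_def)
next
  case (Suc n)
  then show ?case unfolding qpochs_Suc using xseq_Suc_pos[of n] q by simp
qed

text \<open>Dividing by the square root of the normalizing constant turns the Al-Salam-Chihara
  recurrence into the symmetric one with coefficients b_n = sqrt(x_n); both sides start at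
  1.\<close>

lemma normalized_al_salam_chihara:
  assumes s: "s\<^sup>2 = complex_of_real \<alpha>"
  shows "complex_of_real (qpochs [- \<alpha>, q] q n powr (- 1 / 2)) *
      al_salam_chihara n s (- s) q (complex_of_real (x * sqrt (1 - q) / 2))
    = complex_of_real (poly (jacobi_poly (\<lambda>n. sqrt (xseq q \<alpha> n)) n) x)"
proof -
  define b where "b n = sqrt (xseq q \<alpha> n)" for n
  have b: "0 < b (Suc n)" for n by (simp add: b_def xseq_Suc_pos)
  have b2: "xseq q \<alpha> n = (b n)\<^sup>2" for n by (simp add: b_def xseq_nonneg)
  define r where "r = sqrt (1 - q)"
  have r: "0 < r" "1 - q = r\<^sup>2" using q by (simp_all add: r_def)
  define \<kappa> where "\<kappa> n = qpochs [- \<alpha>, q] q n powr (- 1 / 2)" for n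
  have \<kappa>: "\<kappa> n = 1 / sqrt (qpochs [- \<alpha>, q] q n)" for n
    using qpochs_pos[of n] by (simp add: \<kappa>_def powr_minus_divide powr_half_sqrt)
  have \<kappa>0: "\<kappa> 0 = 1" by (simp add: \<kappa> qpochs_def)
  have \<kappa>S: "\<kappa> (Suc n) = \<kappa> n / (r * b (Suc n))" for n
    unfolding \<kappa> qpochs_Suc using r b[of n] by (simp add: real_sqrt_mult b2 r(2))
  define Q where "Q n = al_salam_chihara n s (- s) q (complex_of_real (x * r / 2))" for n
  note rec = al_salam_chihara_recurrence[OF q \<alpha> s, of "complex_of_real (x * r / 2)", folded Q_def]
  \<comment> \<open>2 \<xi> is x r, and (1-q^n)(1+\<alpha> q^(n-1)) is (1-q) x_n = (r
    b_n)^2.\<close>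
  have QS: "Q (Suc n) = of_real (x * r) * Q n - of_real ((r * b n)\<^sup>2) * Q (n - 1)" for n
  proof -
    have "(1 - q ^ n) * (1 + \<alpha> * q ^ (n - 1)) = (1 - q) * xseq q \<alpha> n"
      using q by (simp add: xseq_def qnum_def)
    also have "\<dots> = (r * b n)\<^sup>2" by (simp add: r(2) b2 power_mult_distrib)
    finally have eq: "(1 - of_real q ^ n) * (1 + of_real \<alpha> * of_real q ^ (n - 1)) = complex_of_real ((r * b n)\<^sup>2)"
      by (metis of_real_1 of_real_add of_real_diff of_real_mult of_real_power)
    show ?thesis using rec(2)[of n] unfolding eq by (simp add: algebra_simps)
  qed
  have "of_real (\<kappa> n) * Q n = complex_of_real (poly (jacobi_poly b n) x)"
  proof (induction n rule: less_induct)
    case (less n)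
    show ?case
    proof (cases n)
      case 0
      then show ?thesis by (simp add: rec(1) \<kappa>0)
    next
      case (Suc m)
      have "of_real (\<kappa> n) * Q n = of_real (x / b n) * (of_real (\<kappa> m) * Q m) - of_real (\<kappa> m * r * (b m)\<^sup>2 / b n) * Q (m - 1)"
        unfolding Suc QS \<kappa>S using r(1) b[of m] by (simp add: field_simps power2_eq_square)
      also have "of_real (\<kappa> m * r * (b m)\<^sup>2 / b n) * Q (m - 1) = of_real ((if m = 0 then 0 else b m) / b n) * (of_real (\<kappa> (m - 1)) * Q (m - 1))"
      proof (cases m)
        case 0
        \<comment> \<open>x_0 = 0, so b_0 = 0 and the truncated index m - 1 does no harm.\<close>
        then show ?thesis by (simp add: b_def xseq_def qnum_def)
      next
        case (Suc k)
        then show ?thesis unfolding Suc \<kappa>S using r(1) b[of k] by (simp add: power2_eq_square)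
      qed
      also have "of_real (\<kappa> m) * Q m = complex_of_real (poly (jacobi_poly b m) x)"
        using less[of m] Suc by simp
      also have "of_real (\<kappa> (m - 1)) * Q (m - 1) = complex_of_real (poly (jacobi_poly b (m - 1)) x)"
        using less[of "m - 1"] Suc by simp
      finally have "of_real (\<kappa> n) * Q n = complex_of_real
          (x / b n * poly (jacobi_poly b m) x - (if m = 0 then 0 else b m) / b n * poly (jacobi_poly b (m - 1)) x)"
        by simp
      also have "x / b n * poly (jacobi_poly b m) x - (if m = 0 then 0 else b m) / b n * poly (jacobi_poly b (m - 1)) x
          = (x * poly (jacobi_poly b m) x - (if m = 0 then 0 else b m * poly (jacobi_poly b (m - 1)) x)) / b n"
        by (simp add: diff_divide_distrib)
      also have "\<dots> = poly (jacobi_poly b n) x"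
        using jacobi_poly_recurrence[of b x m] b by (simp add: Suc less_imp_neq[symmetric])
      finally show ?thesis .
    qed
  qed
  then show ?thesis
    by (simp add: \<kappa>_def Q_def r_def b_def[abs_def])
qed

end

theorem proposition2:
  fixes q \<alpha> :: real
    and s :: complex
    and \<phi> :: "nat \<Rightarrow> 'h::complex_hilbert_space"
    and a astar T :: "'h \<Rightarrow> 'h"
    and D :: "'h set"
    and E :: "real \<Rightarrow> 'h \<Rightarrow> 'h"
  assumes "0 < q" and "q < 1" and "-1 < \<alpha>" and "\<alpha> < q"
    and "s\<^sup>2 = complex_of_real \<alpha>"
    and "orthonormal_basis \<phi>"
    and "annihilation_operator q \<alpha> \<phi> a"
    and "creation_operator q \<alpha> \<phi> astar"
    and "self_adjoint D T"
    and "\<forall>u\<in>cvec.span (range \<phi>).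
           u \<in> D \<and> T u = complex_of_real (1 / sqrt 2) *\<^sub>C (a u + astar u)"
    and "spectral_family_of D T E"
  shows "polynomial_realization q \<alpha> \<phi> D T (spectral_distribution E (\<phi> 0))
           (\<lambda>n x. complex_of_real (qpochs [- \<alpha>, q] q n powr (- 1 / 2)) *
                  al_salam_chihara n s (- s) q (complex_of_real (x * sqrt (1 - q) / 2)))"
proof -
  note q = assms(1,2) and \<alpha> = assms(3) and basis = assms(6) and sa = assms(9)
  note on = orthonormal_basis_imp_orthonormal[OF basis]
  define b where "b n = sqrt (xseq q \<alpha> n)" for n
  have b: "0 < b (Suc n)" for n
    by (simp add: b_def xseq_Suc_pos[OF q \<alpha>])
  define p where "p = jacobi_poly b"
  have p_rec: "x * poly (p n) x = (if n = 0 then 0 else b n * poly (p (n - 1)) x) + b (Suc n) * poly (p (Suc n)) x" for n x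
    unfolding p_def by (rule jacobi_poly_recurrence) (use b in \<open>simp add: less_imp_neq[symmetric]\<close>)

  have \<phi>_span: "\<phi> n \<in> cvec.span (range \<phi>)" for n
    by (intro cvec.span_base) auto
  have \<phi>D: "\<phi> n \<in> D" for n
    using assms(10) \<phi>_span by blast
  have half: "(1 / sqrt 2) * sqrt (2 * y) = sqrt y" for y :: real
    by (simp add: real_sqrt_mult)
  have T\<phi>: "T (\<phi> n) = (if n = 0 then 0 else of_real (b n) *\<^sub>C \<phi> (n - 1)) + of_real (b (Suc n)) *\<^sub>C \<phi> (Suc n)" for n
  proof -
    have "T (\<phi> n) = complex_of_real (1 / sqrt 2) *\<^sub>C a (\<phi> n) + complex_of_real (1 / sqrt 2) *\<^sub>C astar (\<phi> n)"
      using assms(10) \<phi>_span by (simp add: scaleC_add_right)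
    moreover have "complex_of_real (1 / sqrt 2) *\<^sub>C a (\<phi> n) = (if n = 0 then 0 else of_real (b n) *\<^sub>C \<phi> (n - 1))"
      using assms(7) half[of "xseq q \<alpha> n"]
      by (simp add: annihilation_operator_def scaleC_scaleC scaleC.zero_right b_def flip: of_real_mult of_real_divide)
    moreover have "complex_of_real (1 / sqrt 2) *\<^sub>C astar (\<phi> n) = of_real (b (Suc n)) *\<^sub>C \<phi> (Suc n)"
      using assms(8) half[of "xseq q \<alpha> (Suc n)"]
      by (simp add: creation_operator_def scaleC_scaleC b_def flip: of_real_mult of_real_divide)
    ultimately show ?thesis by simp
  qed
  have b_le: "\<bar>b n\<bar> \<le> sqrt ((1 + \<bar>\<alpha>\<bar>) / (1 - q))" for n
    unfolding b_def using xseq_le[OF q \<alpha>, of n] xseq_nonneg[OF q \<alpha>, of n] by simp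
  \<comment> \<open>With \<open>D\<close> everything, the description of \<open>D\<close> in
    \<open>spectral_family_of\<close> makes x^2 integrable for the distribution of every
    vector.\<close>
  have D: "D = UNIV" and T_bound: "norm (T u) \<le> 2 * sqrt ((1 + \<bar>\<alpha>\<bar>) / (1 - q)) * norm u" for u
    using self_adjoint_bounded_jacobi[OF sa basis \<phi>D T\<phi> b_le] by auto
  have T_add: "T (u + v) = T u + T v" and T_scale: "T (c *\<^sub>C u) = c *\<^sub>C T u" for u v c
    using sa D by (auto simp: self_adjoint_def clinear_on_def)
  have T_csym: "cinner (T u) v = cinner u (T v)" for u v
    using sa unfolding self_adjoint_def D by blast
  have sf: "spectral_family E"
    and sq: "integrable (spectral_distribution E u) (\<lambda>x. x\<^sup>2)"
    and quad: "cinner u (T u) = complex_of_real (\<integral>x. x \<partial>spectral_distribution E u)" for u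
    using assms(11) D by (auto simp: spectral_family_of_def)
  have sd: "spectral_distribution E u = interval_measure (\<lambda>x. inner u (E x u))" for u
    by (simp add: spectral_distribution_def inner_eq_Re_cinner)
  have E_proj: "orthogonal_projection (E x)" for x
    using sf by (simp add: spectral_family_def)

  interpret spectral_resolution T E "2 * sqrt ((1 + \<bar>\<alpha>\<bar>) / (1 - q))"
  proof
    show "T (u + v) = T u + T v" "T (c *\<^sub>R u) = c *\<^sub>R T u" for u v c
      by (simp_all add: T_add T_scale scaleR_scaleC)
    show "inner (T u) v = inner u (T v)" for u v
      by (simp add: inner_eq_Re_cinner T_csym)
    show "E x (u + v) = E x u + E x v" "E x (c *\<^sub>R u) = c *\<^sub>R E x u" for x u v c
      using E_proj[of x] by (simp_all add: orthogonal_projection_def clinear_on_def scaleR_scaleC)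
    show "inner (E x u) v = inner u (E x v)" for x u v
      using E_proj[of x] by (simp add: inner_eq_Re_cinner orthogonal_projection_def)
    show "inner u (T u) = (\<integral>x. x \<partial>interval_measure (\<lambda>x. inner u (E x u)))" for u
      unfolding sd[symmetric] by (simp add: inner_eq_Re_cinner quad)
  qed (use T_bound sf sq in \<open>auto simp: spectral_family_def sd\<close>)

  define \<omega> where "\<omega> = spectral_distribution E (\<phi> 0)"
  have \<omega>: "\<omega> = distr_at (\<phi> 0)" by (simp add: \<omega>_def sd)
  have inner_\<phi>: "inner (\<phi> m) (\<phi> n) = (if m = n then 1 else 0)" for m n
    using on by (simp add: inner_eq_Re_cinner orthonormal_def)
  have orth: "(\<integral>x. poly (p m) x * poly (p n) x \<partial>\<omega>) = (if m = n then 1 else 0)" for m n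
    unfolding \<omega> inner_\<phi>[symmetric]
  proof (rule integral_mult_orthogonal_polynomials[where P = "\<lambda>n. poly (p n)" and \<phi> = \<phi> and b = b])
    show "poly (p 0) = (\<lambda>x. 1)" by (auto simp: p_def)
    show "continuous_on UNIV (poly (p n))" for n by (intro continuous_intros)
    show "T (\<phi> n) = (if n = 0 then 0 else b n *\<^sub>R \<phi> (n - 1)) + b (Suc n) *\<^sub>R \<phi> (Suc n)" for n
      unfolding T\<phi> scaleR_scaleC ..
  qed (fact b p_rec)+

  interpret orthonormal_polynomials \<omega> "real K" p
  proof (intro orthonormal_polynomials.intro compact_measure.intro)
    show "finite_borel_measure \<omega>"
      unfolding \<omega> by (rule finite_borel_measure_distr_at)
    show "compact_measure_axioms \<omega> (real K)"
    proof
      show "AE x in \<omega>. \<bar>x\<bar> \<le> real K"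
        using AE_distr_at[of "\<phi> 0"] unfolding \<omega> by eventually_elim auto
    qed
    show "orthonormal_polynomials_axioms \<omega> p"
      unfolding p_def using jacobi_poly_degree[of b, OF b] orth[unfolded p_def]
      by (intro orthonormal_polynomials_axioms.intro) blast+
  qed

  obtain U where U: "unitary_onto_L2 \<omega> U" and coeff: "\<And>u n. (\<integral>x. e n x * U u x \<partial>\<omega>) = cinner (\<phi> n) u"
    using exists_unitary[OF basis] by blast
  have UL2: "U u \<in> L2 \<omega>" for u
    using U by (simp add: unitary_onto_L2_def)
  have xUL2: "(\<lambda>x. complex_of_real x * U u x) \<in> L2 \<omega>" for u
    by (rule L2_continuous_mult[OF continuous_on_id UL2])
  have U\<phi>: "AE x in \<omega>. U (\<phi> n) x = e n x" for n
    by (rule AE_eq_of_coeffs[OF UL2 L2_e]) (use on in \<open>simp add: coeff integral_e_e orthonormal_def\<close>)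
  \<comment> \<open>The n-th coefficient of x U u is, by the recurrence, <T \<phi>_n, u>, and by
    symmetry this is <\<phi>_n, T u>, the n-th coefficient of U (T u).\<close>
  have UT: "AE x in \<omega>. U (T u) x = complex_of_real x * U u x" for u
  proof (rule AE_eq_of_coeffs[OF UL2 xUL2])
    fix n
    define d where "d = (if n = 0 then 0 else b n)"
    have "e n x * (complex_of_real x * U u x) = of_real d * (e (n - 1) x * U u x) + of_real (b (Suc n)) * (e (Suc n) x * U u x)" for x
    proof -
      have "e n x * (complex_of_real x * U u x) = complex_of_real (x * poly (p n) x) * U u x"
        by simp
      also have "x * poly (p n) x = d * poly (p (n - 1)) x + b (Suc n) * poly (p (Suc n)) x"
        unfolding p_rec by (simp add: d_def)
      finally show ?thesis by (simp add: algebra_simps)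
    qed
    then have "(\<integral>x. e n x * (complex_of_real x * U u x) \<partial>\<omega>) = of_real d * cinner (\<phi> (n - 1)) u + of_real (b (Suc n)) * cinner (\<phi> (Suc n)) u"
      using integrable_e_mult[OF UL2] by (simp add: coeff)
    also have "\<dots> = cinner (T (\<phi> n)) u"
      by (simp add: T\<phi> d_def cinner_add_left cinner_scaleC_left cinner.zero_left)
    finally show "(\<integral>x. e n x * U (T u) x \<partial>\<omega>) = (\<integral>x. e n x * (complex_of_real x * U u x) \<partial>\<omega>)"
      by (simp add: coeff T_csym)
  qed
  have f: "complex_of_real (qpochs [- \<alpha>, q] q n powr (- 1 / 2)) *
      al_salam_chihara n s (- s) q (complex_of_real (x * sqrt (1 - q) / 2)) = e n x" for n x
    using normalized_al_salam_chihara[OF q \<alpha> assms(5), of n x] by (simp add: p_def b_def[abs_def])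
  show ?thesis
    unfolding polynomial_realization_def f \<omega>_def[symmetric]
  proof (intro conjI exI[of _ p] exI[of _ U])
    show "\<forall>n x. x * poly (p n) x = (if n = 0 then 0 else sqrt (xseq q \<alpha> n) * poly (p (n - 1)) x)
             + sqrt (xseq q \<alpha> (n + 1)) * poly (p (n + 1)) x"
      using p_rec by (simp add: b_def)
  \<comment> \<open>The domain condition holds because both sides are always true: \<open>D\<close>
    is everything, and x U u always lies in L2.\<close>
  qed (use orth U U\<phi> UT xUL2 degree_p orthonormalized_monomials_p D in \<open>auto simp: p_def\<close>)
qed

end
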